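(* Let $A\in\mathbb{Z}$, $A\geq 2$, let $B$ be a finite set of integers with $0\in B$, and let $\mu_B$ be the invariant measure associated to the affine iterated function system $\tau_b(x)=A^{-1}(x+b)$, $x\in\mathbb{R}$, $b\in B$. Suppose there exists a set $L$ of integers with $0\in L$ such that $A^{-1}L$ is a spectrum for $B$. If $\#B<A$, then $\mu_B$ has infinitely many spectra.
   Context: For $\lambda\in\mathbb{R}$ let $e_\lambda(x)=e^{2\pi i\lambda x}$. A set $\Lambda\subset\mathbb{R}$ is a spectrum for a finite Borel measure $\mu$ on $\mathbb{R}$ if the family $(e_\lambda)_{\lambda\in\Lambda}$ is an orthogonal basis of $L^2(\mu)$. A spectrum for a finite set $B\subset\mathbb{R}$ is a spectrum for $\delta_B=\frac{1}{\#B}\sum_{b\in B}\delta_b$. The invariant measure $\mu_B$ is the unique Borel probability measure on $\mathbb{R}$ such that $\int f\,d\mu_B=\frac{1}{\#B}\sum_{b\in B}\int f\circ\tau_b\,d\mu_B$ for all $f\in C_c(\mathbb{R})$. *)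

theory Defs
  imports "HOL-Probability.Probability"
begin

definition expo :: "real \<Rightarrow> real \<Rightarrow> complex" where
  "expo t x = exp (2 * of_real pi * \<i> * of_real t * of_real x)"

text \<open>Elements of the complex Hilbert space $L^2(\mu)$ are represented by square-integrable
  functions, with the inner product and squared norm computed on representatives.\<close>

definition square_integrable :: "real measure \<Rightarrow> (real \<Rightarrow> complex) \<Rightarrow> bool" where
  "square_integrable \<mu> f \<longleftrightarrow> f \<in> borel_measurable \<mu> \<and> integrable \<mu> (\<lambda>x. (norm (f x))\<^sup>2)"

definition L2_inner :: "real measure \<Rightarrow> (real \<Rightarrow> complex) \<Rightarrow> (real \<Rightarrow> complex) \<Rightarrow> complex" where
  "L2_inner \<mu> f g = (LINT x|\<mu>. f x * cnj (g x))"

definition L2_norm :: "real measure \<Rightarrow> (real \<Rightarrow> complex) \<Rightarrow> real" where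
  "L2_norm \<mu> f = sqrt (LINT x|\<mu>. (norm (f x))\<^sup>2)"

text \<open>An orthogonal basis is a family of nonzero, pairwise orthogonal vectors whose
  (finite) linear span is dense.\<close>

definition orthogonal_basis :: "real measure \<Rightarrow> 'i set \<Rightarrow> ('i \<Rightarrow> real \<Rightarrow> complex) \<Rightarrow> bool" where
  "orthogonal_basis \<mu> I e \<longleftrightarrow>
     (\<forall>i\<in>I. square_integrable \<mu> (e i) \<and> L2_norm \<mu> (e i) \<noteq> 0) \<and>
     (\<forall>i\<in>I. \<forall>j\<in>I. i \<noteq> j \<longrightarrow> L2_inner \<mu> (e i) (e j) = 0) \<and>
     (\<forall>f. square_integrable \<mu> f \<longrightarrow>
        (\<forall>\<epsilon>>0. \<exists>F c. finite F \<and> F \<subseteq> I \<and>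
           L2_norm \<mu> (\<lambda>x. f x - (\<Sum>i\<in>F. c i * e i x)) < \<epsilon>))"

definition is_spectrum :: "real measure \<Rightarrow> real set \<Rightarrow> bool" where
  "is_spectrum \<mu> \<Lambda> \<longleftrightarrow> orthogonal_basis \<mu> \<Lambda> expo"

text \<open>Normalised counting measure on a finite set, as a Borel measure on the line; the lemma
  below identifies it with the average of the Dirac measures.\<close>

definition delta_measure :: "real set \<Rightarrow> real measure" where
  "delta_measure B = distr (uniform_count_measure B) borel (\<lambda>x. x)"

lemma emeasure_delta_measure:
  assumes "finite B" "E \<in> sets borel"
  shows "emeasure (delta_measure B) E
    = ennreal (1 / real (card B)) * (\<Sum>b\<in>B. emeasure (return borel b) E)"
proof -
  have "emeasure (delta_measure B) E = emeasure (uniform_count_measure B) (E \<inter> B)"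
    unfolding delta_measure_def using assms(2)
    by (subst emeasure_distr) (auto simp: space_uniform_count_measure
        measurable_def sets_uniform_count_measure)
  also have "\<dots> = ennreal (1 / real (card B)) * of_nat (card (E \<inter> B))"
    using assms(1) by (simp add: emeasure_uniform_count_measure ennreal_of_nat_eq_real_of_nat
        flip: ennreal_mult)
  also have "of_nat (card (E \<inter> B)) = (\<Sum>b\<in>B. emeasure (return borel b) E)"
    using assms by (simp add: indicator_def sum.If_cases Int_def conj_commute
        flip: sum.inter_filter)
  finally show ?thesis .
qed

definition is_spectrum_of_set :: "real set \<Rightarrow> real set \<Rightarrow> bool" where
  "is_spectrum_of_set B \<Lambda> \<longleftrightarrow> is_spectrum (delta_measure B) \<Lambda>"

definition ifs_map :: "int \<Rightarrow> int \<Rightarrow> real \<Rightarrow> real" where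
  "ifs_map A b x = inverse (real_of_int A) * (x + real_of_int b)"

definition Cc :: "(real \<Rightarrow> complex) set" where
  "Cc = {f. continuous_on UNIV f \<and> compact (closure {x. f x \<noteq> 0})}"

definition invariant_measure :: "int \<Rightarrow> int set \<Rightarrow> real measure" where
  "invariant_measure A B = (THE \<mu>. prob_space \<mu> \<and> sets \<mu> = sets borel \<and>
     (\<forall>f\<in>Cc. (LINT x|\<mu>. f x) =
        1 / of_nat (card B) * (\<Sum>b\<in>B. LINT x|\<mu>. (f \<circ> ifs_map A b) x)))"

end

theory Submission
  imports Defs "HOL-Complex_Analysis.Complex_Analysis"
begin

text \<open>Translates of a spectrum are spectra, and distinct small translates differ, so a single spectrum
  of \<open>\<mu>\<^sub>B\<close> suffices. Let \<open>H\<close> be the Fourier transform of \<open>\<mu>\<^sub>B\<close> and \<open>m\<close> that of the uniform measure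
  on \<open>B\<close>, so that \<open>H x = m (x / A) H (x / A)\<close>, and let \<open>G\<close> be the group of common periods
  \<open>{t. \<forall>b\<in>B. t b \<in> \<int>}\<close>. Spectra \<open>\<Lambda>\<close> of the \<open>n\<close>-th convolution approximations of \<open>\<mu>\<^sub>B\<close> are built from
  \<open>L\<close>, with the freedom to translate frequencies by \<open>A\<^sup>n G\<close>. No \<open>x\<close> has \<open>H = 0\<close> on all of \<open>x + G\<close>, so by
  compactness the translations can be chosen, along an increasing sequence of such \<open>\<Lambda>\<close>, with
  \<open>\<bar>H (- \<lambda> / A\<^sup>n)\<bar> \<ge> \<epsilon>\<close> for all \<open>\<lambda> \<in> \<Lambda>\<close>. Comparing with the approximating measures gives a lower frame bound
  for trigonometric polynomials on the union of the sequence, hence completeness.\<close>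

section \<open>Mask products and tight frequency sets\<close>

text \<open>A tight set is complete for its own approximating measure, yet an increasing union of
  tight sets may be incomplete for the limit. In
  \<open>H (t - l) = M n (t - l) * H ((t - l) / a ^ n)\<close> the frequency \<open>l\<close> can be
  as large as \<open>a ^ n\<close>, so the last factor need not be close to 1 uniformly in
  \<open>l\<close>; where it is small, energy is lost in the limit. Since \<open>t / a ^ n\<close>
  is negligible for fixed \<open>t\<close>, a uniform lower bound on
  \<open>norm (H (- l / a ^ n))\<close> is what prevents this. Shifting \<open>l\<close> by
  \<open>a ^ n * g\<close> with \<open>g\<close> in \<open>G\<close> leaves \<open>M n\<close>
  unchanged and moves \<open>- l / a ^ n\<close> by \<open>- g\<close>, so the available freedom
  acts exactly on the quantity to be bounded. The shifts range over \<open>G\<close> and not only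
  over the integers: \<open>G\<close> is larger when the elements of \<open>B\<close> have a common
  factor, so the spectrum found need not consist of integers. Common zeros are excluded along cosets
  of \<open>G\<close> because a point where the mask has modulus 1 is only known to lie in
  \<open>G\<close>.\<close>

lemma norm_expo [simp]: "norm (expo t x) = 1"
proof -
  have "expo t x = exp (\<i> * of_real (2 * pi * t * x))"
    by (simp add: expo_def mult_ac)
  then show ?thesis by simp
qed

lemma expo_0 [simp]: "expo 0 x = 1" "expo t 0 = 1"
  by (simp_all add: expo_def)

lemma expo_add: "expo (s + t) x = expo s x * expo t x"
  by (simp add: expo_def exp_add [symmetric] algebra_simps)

lemma expo_minus: "expo (- t) x = cnj (expo t x)"
  by (simp add: expo_def exp_cnj)

lemma expo_diff: "expo (s - t) x = expo s x * cnj (expo t x)"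
  using expo_add [of s "- t" x] by (simp add: expo_minus)

lemma expo_int:
  assumes "t * x \<in> \<int>"
  shows "expo t x = 1"
proof -
  obtain k :: int where "t * x = of_int k" using assms by (auto elim: Ints_cases)
  then have "complex_of_real t * complex_of_real x = of_int k"
    by (metis of_real_mult of_real_of_int_eq)
  then have "2 * of_real pi * \<i> * of_real t * of_real x = 2 * of_int k * of_real pi * \<i>"
    by (metis (no_types, opaque_lifting) mult.assoc mult.commute)
  then have "expo t x = exp ((2 * of_int k * pi) * \<i>)"
    unfolding expo_def by (simp only: of_real_mult of_real_of_int_eq of_real_numeral)
  then show ?thesis using exp_integer_2pi [of "of_int k"] by simp
qed

lemma expo_eq_1_iff: "expo t x = 1 \<longleftrightarrow> t * x \<in> \<int>"
proof
  assume "expo t x = 1"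
  then obtain n :: int where "2 * pi * t * x = of_int (2 * n) * pi"
    by (auto simp: expo_def exp_eq_1)
  then have "t * x = of_int n" by simp
  then show "t * x \<in> \<int>" by simp
qed (rule expo_int)

definition mask :: "int set \<Rightarrow> real \<Rightarrow> complex" where
  "mask B x = (\<Sum>b\<in>B. expo x (of_int b)) / of_nat (card B)"

text \<open>The mask extends to an entire function with value 1 at 0, so its zeros in a compact set
  are finite in number. The identity theorem asks for a nonconstant function; a constant one is 1
  everywhere and has no zeros.\<close>

lemma finite_zeros_mask:
  assumes "finite B" "B \<noteq> {}"
  shows "finite {x \<in> {0..1}. mask B x = 0}"
proof -
  define f where "f z = (\<Sum>b\<in>B. exp (2 * of_real pi * \<i> * z * of_int b)) / of_nat (card B)" for z
  have f: "f (of_real x) = mask B x" for x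
    by (simp add: f_def mask_def expo_def)
  have f0: "f 0 = 1" using assms by (simp add: f_def)
  have fin: "finite {z \<in> cball 0 1. f z = 0}"
  proof (cases "f constant_on UNIV")
    case True
    then have "f z = 1" for z by (metis f0 UNIV_I constant_on_def)
    then show ?thesis by simp
  next
    case False
    show ?thesis
      by (rule holomorphic_compact_finite_zeros [of f UNIV])
         (use False in \<open>auto simp: f_def [abs_def] intro!: holomorphic_intros\<close>)
  qed
  have "of_real ` {x \<in> {0..1}. mask B x = 0} \<subseteq> {z \<in> cball 0 1. f z = 0}"
    by (auto simp: f)
  then have "finite (complex_of_real ` {x \<in> {0..1}. mask B x = 0})"
    using fin finite_subset by blast
  then show ?thesis by (rule finite_imageD) (simp add: inj_on_def)
qed

text \<open>Equality in the triangle inequality: an average of unit vectors has modulus 1 only if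
  all of them equal the average \<open>w\<close>. The vector for the digit 0 is 1, hence
  \<open>w = 1\<close>.\<close>

lemma mask_norm_1:
  assumes "finite B" "0 \<in> B" "norm (mask B x) = 1" "b \<in> B"
  shows "x * of_int b \<in> \<int>"
proof -
  define w where "w = mask B x"
  have N: "card B > 0" using assms by (auto simp: card_gt_0_iff)
  have "(\<Sum>b\<in>B. expo x (of_int b)) = w * of_nat (card B)"
    using N by (simp add: w_def mask_def)
  moreover have "cnj w * w = 1"
    using assms(3) by (metis complex_norm_square mult.commute of_real_1 power_one w_def)
  ultimately have "(\<Sum>b\<in>B. cnj w * expo x (of_int b)) = of_nat (card B)"
    by (simp add: sum_distrib_left [symmetric] mult.assoc [symmetric])
  then have "(\<Sum>b\<in>B. Re (cnj w * expo x (of_int b))) = real (card B)"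
    by (metis Re_sum complex_Re_of_nat)
  then have s0: "(\<Sum>b\<in>B. 1 - Re (cnj w * expo x (of_int b))) = 0"
    by (simp add: sum_subtractf)
  have nw: "norm (cnj w * expo x (of_int b)) = 1" for b
    using assms(3) by (simp add: norm_mult w_def)
  have le: "0 \<le> 1 - Re (cnj w * expo x (of_int b))" for b
    using complex_Re_le_cmod [of "cnj w * expo x (of_int b)"] nw [of b] by simp
  have eq: "cnj w * expo x (of_int b) = 1" if "b \<in> B" for b
  proof -
    have re: "Re (cnj w * expo x (of_int b)) = 1"
      using s0 sum_nonneg_eq_0_iff [OF assms(1), of "\<lambda>b. 1 - Re (cnj w * expo x (of_int b))"] le that
      by auto
    have "(Re (cnj w * expo x (of_int b)))\<^sup>2 + (Im (cnj w * expo x (of_int b)))\<^sup>2 = 1"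
      using nw [of b] cmod_power2 [of "cnj w * expo x (of_int b)"] by simp
    then show ?thesis using re by (simp add: complex_eq_iff)
  qed
  from eq [OF assms(2)] have "cnj w = 1" by simp
  with eq [OF assms(4)] show ?thesis by (simp add: expo_eq_1_iff)
qed

text \<open>\<open>hadamard_sum\<close> is Parseval's identity for two characters with arbitrary
  real frequencies, expanded over \<open>L / A\<close> in the space of functions on
  \<open>B\<close>. It encodes orthogonality and completeness at once, and in this two-variable form
  it can be multiplied scale by scale.\<close>

locale hadamard =
  fixes A :: int and B L :: "int set"
  assumes A: "A \<ge> 2" and fin_B: "finite B" and zero_B: "0 \<in> B"
    and fin_L: "finite L" and zero_L: "0 \<in> L"
    and hadamard_sum: "\<And>x y. (\<Sum>l\<in>L. mask B ((x - of_int l) / of_int A) *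
      cnj (mask B ((y - of_int l) / of_int A))) = mask B ((x - y) / of_int A)"
begin

abbreviation a :: real where "a \<equiv> of_int A"

abbreviation m :: "real \<Rightarrow> complex" where "m \<equiv> mask B"

definition M :: "nat \<Rightarrow> real \<Rightarrow> complex" where
  "M n x = (\<Prod>k<n. m (x / a ^ Suc k))"

definition G :: "real set" where
  "G = {t. \<forall>b\<in>B. t * of_int b \<in> \<int>}"

lemma a: "a \<ge> 2" "a > 0" "a \<noteq> 0"
  using A by auto

lemma B_nonempty: "B \<noteq> {}" "card B > 0"
  using zero_B fin_B by (auto simp: card_gt_0_iff)

lemma m_0 [simp]: "m 0 = 1"
  using B_nonempty fin_B by (simp add: mask_def)

lemma M_at_0 [simp]: "M n 0 = 1"
  by (simp add: M_def)

lemma M_0 [simp]: "M 0 x = 1"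
  by (simp add: M_def)

lemma M_1: "M (Suc 0) x = m (x / a)"
  by (simp add: M_def)

lemma M_add: "M (n + k) x = M n x * M k (x / a ^ n)"
proof -
  have "M (n + k) x = (\<Prod>j<n. m (x / a ^ Suc j)) * (\<Prod>j\<in>{n..<n+k}. m (x / a ^ Suc j))"
    unfolding M_def by (simp add: prod.atLeastLessThan_concat lessThan_atLeast0)
  also have "(\<Prod>j\<in>{n..<n+k}. m (x / a ^ Suc j)) = (\<Prod>j<k. m (x / a ^ Suc (j + n)))"
    using prod.shift_bounds_nat_ivl [of "\<lambda>j. m (x / a ^ Suc j)" 0 n k]
    by (simp add: lessThan_atLeast0 add.commute)
  also have "\<dots> = M k (x / a ^ n)"
    unfolding M_def by (simp add: power_add mult_ac)
  finally show ?thesis by (simp add: M_def)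
qed

lemma Ints_G: "\<int> \<subseteq> G"
  by (auto simp: G_def)

lemma G_add: "s \<in> G \<Longrightarrow> t \<in> G \<Longrightarrow> s + t \<in> G"
  by (auto simp: G_def distrib_right)

lemma G_minus: "s \<in> G \<Longrightarrow> - s \<in> G"
  by (auto simp: G_def)

lemma G_mult: "s \<in> G \<Longrightarrow> a ^ n * s \<in> G"
  by (auto simp: G_def mult.assoc)

lemma m_period: "t \<in> G \<Longrightarrow> m (x + t) = m x"
  by (simp add: mask_def G_def expo_add expo_int)

lemma M_period:
  assumes "t \<in> G"
  shows "M n (x + a ^ n * t) = M n x"
proof -
  have "m ((x + a ^ n * t) / a ^ Suc k) = m (x / a ^ Suc k)" if "k < n" for k
  proof -
    have "n = Suc k + (n - Suc k)" using that by simp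
    then have "a ^ n = a ^ Suc k * a ^ (n - Suc k)" by (metis power_add)
    then have "(x + a ^ n * t) / a ^ Suc k = x / a ^ Suc k + a ^ (n - Suc k) * t"
      using a by (simp add: field_simps)
    then show ?thesis using m_period G_mult [OF assms] by metis
  qed
  then show ?thesis by (simp add: M_def)
qed

text \<open>\<open>tight n \<Lambda>\<close> is Parseval's identity for the characters with frequencies in \<open>\<Lambda>\<close> and the
  convolution of the uniform measures on \<open>A\<^sup>-\<^sup>1 B, \<dots>, A\<^sup>-\<^sup>n B\<close>, whose Fourier transform is \<open>M n\<close>.\<close>

definition tight :: "nat \<Rightarrow> real set \<Rightarrow> bool" where
  "tight n \<Lambda> \<longleftrightarrow> finite \<Lambda> \<and> \<Lambda> \<subseteq> G \<and>
     (\<forall>x y. (\<Sum>l\<in>\<Lambda>. M n (x - l) * cnj (M n (y - l))) = M n (x - y))"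

text \<open>At \<open>x = y = f i\<close> the squared moduli add up to 1, and the term with index
  \<open>i\<close> alone contributes \<open>M n 0 = 1\<close>; all others must vanish.\<close>

lemma tight_family_orthogonal:
  assumes fin: "finite I"
    and S: "\<And>x y. (\<Sum>i\<in>I. M n (x - f i) * cnj (M n (y - f i))) = M n (x - y)"
    and ij: "i \<in> I" "j \<in> I" "i \<noteq> j"
  shows "M n (f i - f j) = 0"
proof -
  have "complex_of_real (\<Sum>k\<in>I. (norm (M n (f i - f k)))\<^sup>2) = 1"
    using S [of "f i" "f i"] by (simp add: complex_norm_square del: of_real_power)
  then have "(\<Sum>k\<in>I. (norm (M n (f i - f k)))\<^sup>2) = 1"
    by (metis of_real_eq_1_iff)
  then have "(\<Sum>k\<in>I-{i}. (norm (M n (f i - f k)))\<^sup>2) = 0"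
    using sum.remove [OF fin ij(1), of "\<lambda>k. (norm (M n (f i - f k)))\<^sup>2"] by simp
  then show ?thesis
    using sum_nonneg_eq_0_iff [of "I - {i}" "\<lambda>k. (norm (M n (f i - f k)))\<^sup>2"] fin ij by auto
qed

lemma tight_orthogonal:
  assumes "tight n \<Lambda>" "l \<in> \<Lambda>" "l' \<in> \<Lambda>" "l \<noteq> l'"
  shows "M n (l - l') = 0"
  using tight_family_orthogonal [of \<Lambda> n id l l'] assms by (auto simp: tight_def)

text \<open>Injectivity of \<open>f\<close> comes for free: a repeated frequency would force
  \<open>M n 0 = 0\<close>. Hence no collisions have to be ruled out by hand after arbitrary
  shifts.\<close>

lemma tight_family:
  assumes fin: "finite I" and fG: "f ` I \<subseteq> G"
    and S: "\<And>x y. (\<Sum>i\<in>I. M n (x - f i) * cnj (M n (y - f i))) = M n (x - y)"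
  shows "tight n (f ` I)"
proof -
  have "inj_on f I"
  proof (rule inj_onI, rule ccontr)
    fix i j assume "i \<in> I" "j \<in> I" "f i = f j" "i \<noteq> j"
    with tight_family_orthogonal [of I n f i j] fin S show False by simp
  qed
  then show ?thesis using fin fG S by (simp add: tight_def sum.reindex)
qed

lemma tight_0: "tight 0 {0}"
  using Ints_G by (auto simp: tight_def)

lemma tight_1: "tight 1 (of_int ` L)"
proof (rule tight_family)
  show "(\<Sum>i\<in>L. M 1 (x - of_int i) * cnj (M 1 (y - of_int i))) = M 1 (x - y)" for x y
    unfolding One_nat_def M_1 by (rule hadamard_sum)
qed (use fin_L Ints_G in auto)

text \<open>Since \<open>M (n + k)\<close> has the periods \<open>a ^ (n + k) * G\<close>, every new frequency may be shifted
  by such a period; this freedom is used to keep the limit transform away from its zeros.\<close>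

lemma tight_compose:
  assumes 1: "tight n \<Lambda>" and 2: "tight k \<Lambda>'" and g: "\<And>l l'. g l l' \<in> G"
  shows "tight (n + k) ((\<lambda>(l, l'). l + a ^ n * (l' + a ^ k * g l l')) ` (\<Lambda> \<times> \<Lambda>'))"
proof (rule tight_family)
  show "finite (\<Lambda> \<times> \<Lambda>')" using 1 2 by (simp add: tight_def)
  show "(\<lambda>(l, l'). l + a ^ n * (l' + a ^ k * g l l')) ` (\<Lambda> \<times> \<Lambda>') \<subseteq> G"
    using 1 2 g by (auto simp: tight_def intro!: G_add G_mult)
  fix x y
  have *: "M (n + k) (x - (l + a ^ n * (l' + a ^ k * g l l'))) = M n (x - l) * M k ((x - l) / a ^ n - l')"
    if "l' \<in> \<Lambda>'" for x l l'
  proof -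
    \<comment> \<open>This is why \<open>tight\<close> demands frequencies in \<open>G\<close>: the
      entire increment \<open>a ^ n * (l' + ...)\<close> is a period of \<open>M n\<close>, whereas
      \<open>M k\<close> ignores only the part coming from \<open>g\<close>.\<close>
    have "- (l' + a ^ k * g l l') \<in> G"
      by (rule G_minus, rule G_add) (use that 2 g G_mult in \<open>auto simp: tight_def\<close>)
    from M_period [OF this, of n "x - l"]
    have "M n (x - (l + a ^ n * (l' + a ^ k * g l l'))) = M n (x - l)"
      by (simp add: algebra_simps)
    moreover have "(x - (l + a ^ n * (l' + a ^ k * g l l'))) / a ^ n =
        ((x - l) / a ^ n - l') + a ^ k * (- g l l')"
      using a by (simp add: field_simps)
    ultimately show ?thesis
      by (simp only: M_add M_period [OF G_minus [OF g]])
  qed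
  have "(\<Sum>i\<in>\<Lambda> \<times> \<Lambda>'. M (n + k) (x - (case i of (l, l') \<Rightarrow> l + a ^ n * (l' + a ^ k * g l l'))) *
      cnj (M (n + k) (y - (case i of (l, l') \<Rightarrow> l + a ^ n * (l' + a ^ k * g l l')))))
    = (\<Sum>l\<in>\<Lambda>. \<Sum>l'\<in>\<Lambda>'. M n (x - l) * cnj (M n (y - l)) *
        (M k ((x - l) / a ^ n - l') * cnj (M k ((y - l) / a ^ n - l'))))"
    unfolding sum.cartesian_product
    by (rule sum.cong [OF refl], clarify, subst (1 2) *) (simp_all add: mult_ac)
  also have "\<dots> = (\<Sum>l\<in>\<Lambda>. M n (x - l) * cnj (M n (y - l)) * M k ((x - y) / a ^ n))"
    using 2 by (simp add: sum_distrib_left [symmetric] tight_def diff_divide_distrib)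
  also have "\<dots> = M (n + k) (x - y)"
    using 1 by (simp add: sum_distrib_right [symmetric] tight_def M_add)
  finally show "(\<Sum>i\<in>\<Lambda> \<times> \<Lambda>'. M (n + k) (x - (case i of (l, l') \<Rightarrow> l + a ^ n * (l' + a ^ k * g l l'))) *
      cnj (M (n + k) (y - (case i of (l, l') \<Rightarrow> l + a ^ n * (l' + a ^ k * g l l'))))) = M (n + k) (x - y)" .
qed

text \<open>Unshifted digit expansions over \<open>L\<close>. Containing 0 is what lets old
  frequencies survive when such a block is appended.\<close>

lemma tight_exists: "\<exists>\<Lambda>. tight k \<Lambda> \<and> 0 \<in> \<Lambda>"
proof (induction k)
  case 0
  show ?case using tight_0 by blast
next
  case (Suc k)
  then obtain \<Lambda> where \<Lambda>: "tight k \<Lambda>" "0 \<in> \<Lambda>" by blast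
  have "tight (k + 1) ((\<lambda>(l, l'). l + a ^ k * (l' + a ^ 1 * 0)) ` (\<Lambda> \<times> (of_int ` L)))"
    by (rule tight_compose) (use \<Lambda> tight_1 Ints_G in auto)
  moreover have "0 \<in> (\<lambda>(l, l'). l + a ^ k * (l' + a ^ 1 * 0)) ` (\<Lambda> \<times> (real_of_int ` L))"
    using \<Lambda> zero_L by (force intro!: image_eqI [of _ _ "(0, 0)"])
  ultimately show ?case by (metis Suc_eq_plus1)
qed

lemma norm_sum_hadamard: "(\<Sum>l\<in>L. (norm (m ((x - of_int l) / a)))\<^sup>2) = 1"
proof -
  have "complex_of_real (\<Sum>l\<in>L. (norm (m ((x - of_int l) / a)))\<^sup>2) = 1"
    using hadamard_sum [of x x] by (simp add: complex_norm_square del: of_real_power)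
  then show ?thesis by (metis of_real_eq_1_iff)
qed

text \<open>Distinct digits are orthogonal, but the mask has period 1 and equals 1 at 0, so it
  cannot vanish at the integer \<open>k\<close>.\<close>

lemma L_cong_eq:
  assumes "l \<in> L" "l' \<in> L" "of_int l - of_int l' = a * of_int k"
  shows "l = l'"
proof (rule ccontr)
  assume "l \<noteq> l'"
  have "(\<Sum>i\<in>L. M (Suc 0) (x - of_int i) * cnj (M (Suc 0) (y - of_int i))) = M (Suc 0) (x - y)" for x y
    unfolding M_1 by (rule hadamard_sum)
  from tight_family_orthogonal [OF fin_L this assms(1,2) \<open>l \<noteq> l'\<close>]
  have "m (of_int k) = 0" using assms(3) a by (simp add: M_1)
  moreover have "m (0 + of_int k) = m 0" by (rule m_period) (use Ints_G in auto)
  ultimately show False by simp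
qed

end

section \<open>The limit transform, its zeros, and the choice of shifts\<close>

locale hadamard_transform = hadamard +
  fixes H :: "real \<Rightarrow> complex"
  assumes H_step: "\<And>x. H x = m (x / a) * H (x / a)"
    and H_cont: "\<And>x. isCont H x" and H_0 [simp]: "H 0 = 1"
begin

lemma H_eq: "H x = M n x * H (x / a ^ n)"
proof (induction n)
  case (Suc n)
  then show ?case using M_add [of n 1 x] H_step [of "x / a ^ n"] by (simp add: M_1 mult_ac)
qed simp

lemma H_div_tendsto: "(\<lambda>n. H (x / a ^ n)) \<longlonglongrightarrow> 1"
proof -
  have "(\<lambda>n. x / a ^ n) \<longlonglongrightarrow> 0"
    using a by real_asymp
  from isCont_tendsto_compose [OF H_cont this] show ?thesis by simp
qed

text \<open>Divide \<open>H_eq\<close> by \<open>H (x / a ^ n)\<close>, which tends to 1 and is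
  therefore eventually nonzero.\<close>

lemma M_tendsto: "(\<lambda>n. M n x) \<longlonglongrightarrow> H x"
proof -
  have "(\<lambda>n. H x / H (x / a ^ n)) \<longlonglongrightarrow> H x / 1"
    by (intro tendsto_intros H_div_tendsto) auto
  moreover have "\<forall>\<^sub>F n in sequentially. H (x / a ^ n) \<noteq> 0"
    by (rule tendsto_imp_eventually_ne [OF H_div_tendsto]) auto
  then have "\<forall>\<^sub>F n in sequentially. H x / H (x / a ^ n) = M n x"
    by (rule eventually_mono) (use H_eq [of x] in \<open>auto simp: field_simps\<close>)
  ultimately show ?thesis by (simp add: tendsto_cong)
qed

lemma H_nonzero_near_0: "\<exists>\<delta>>0. \<forall>u. \<bar>u\<bar> < \<delta> \<longrightarrow> H u \<noteq> 0"
proof -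
  have "\<forall>\<^sub>F u in at 0. H u \<noteq> 0"
    using H_cont [of 0] by (intro tendsto_imp_eventually_ne [of H 1]) (auto simp: isCont_def)
  then obtain \<delta> where "\<delta> > 0" "\<And>u. u \<noteq> 0 \<Longrightarrow> \<bar>u\<bar> < \<delta> \<Longrightarrow> H u \<noteq> 0"
    by (auto simp: eventually_at dist_real_def)
  then show ?thesis by (metis H_0 zero_neq_one)
qed

text \<open>For a fixed large \<open>n\<close> the factor \<open>H (x / a ^ n)\<close> has no zeros
  on the unit interval, so every zero there stems from one of \<open>n\<close> rescaled
  masks.\<close>

lemma finite_zeros_H: "finite {x \<in> {0..1}. H x = 0}"
proof -
  obtain \<delta> where \<delta>: "\<delta> > 0" "\<And>u. \<bar>u\<bar> < \<delta> \<Longrightarrow> H u \<noteq> 0"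
    using H_nonzero_near_0 by blast
  have "(\<lambda>n. 1 / a ^ n) \<longlonglongrightarrow> 0" using a by real_asymp
  then have "\<forall>\<^sub>F n in sequentially. 1 / a ^ n < \<delta>"
    using \<delta>(1) by (rule order_tendstoD)
  then obtain n where n: "1 / a ^ n < \<delta>" by (auto simp: eventually_sequentially)
  define Z where "Z = {x \<in> {0..1}. m x = 0}"
  have "{x \<in> {0..1}. H x = 0} \<subseteq> (\<Union>k<n. (\<lambda>y. a ^ Suc k * y) ` Z)"
  proof
    fix x assume x: "x \<in> {x \<in> {0..1}. H x = 0}"
    have "\<bar>x / a ^ n\<bar> \<le> 1 / a ^ n" using x a by (simp add: divide_right_mono)
    then have "H (x / a ^ n) \<noteq> 0" using \<delta> n by force
    then have "M n x = 0" using H_eq [of x n] x by simp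
    then obtain k where k: "k < n" "m (x / a ^ Suc k) = 0" by (auto simp: M_def)
    have "1 \<le> a ^ Suc k" using a by (intro one_le_power) auto
    moreover have "0 \<le> x" "x \<le> 1" using x by auto
    ultimately have "x / a ^ Suc k \<in> Z"
      using k(2) by (auto simp: Z_def divide_le_eq)
    moreover have "x = a ^ Suc k * (x / a ^ Suc k)" using a by simp
    ultimately show "x \<in> (\<Union>k<n. (\<lambda>y. a ^ Suc k * y) ` Z)" using k(1) by blast
  qed
  moreover have "finite Z" unfolding Z_def
    using finite_zeros_mask fin_B B_nonempty by blast
  ultimately show ?thesis by (meson finite_UN finite_imageI finite_lessThan finite_subset)
qed

text \<open>The set \<open>Z\<close> of common zeros is finite modulo 1. The graph with an edge from \<open>x\<close> to
  \<open>(x - l) / A\<close> whenever \<open>m\<close> does not vanish there preserves \<open>Z\<close>, has out-degree at least one, and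
  is injective since multiplication by \<open>A\<close> inverts every edge. Hence some vertex has out-degree
  exactly one, where \<open>m\<close> has modulus 1; that forces the target into \<open>G\<close>, so \<open>H 0 = 0\<close>.\<close>

lemma no_periodic_zero: "\<exists>g\<in>G. H (x + g) \<noteq> 0"
proof (rule ccontr)
  define Z where "Z = {x. \<forall>g\<in>G. H (x + g) = 0}"
  define Z0 where "Z0 = {x \<in> Z. 0 \<le> x \<and> x < 1}"
  assume "\<not> ?thesis"
  then have "x \<in> Z" by (auto simp: Z_def)
  have Z_shift: "y + g \<in> Z" if "y \<in> Z" "g \<in> G" for y g
    using that by (auto simp: Z_def add.assoc G_add)
  have frac_Z0: "frac y \<in> Z0" if "y \<in> Z" for y
  proof -
    have "y + (- of_int \<lfloor>y\<rfloor>) \<in> Z" by (rule Z_shift [OF that]) (use Ints_G in auto)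
    then show ?thesis by (simp add: Z0_def frac_def frac_lt_1 [unfolded frac_def])
  qed
  have Z_zero: "H y = 0" if "y \<in> Z" for y
    using that Ints_G by (force simp: Z_def dest: bspec [of _ _ 0])
  have "Z0 \<noteq> {}" using frac_Z0 [OF \<open>x \<in> Z\<close>] by blast
  have "finite Z0"
    by (rule finite_subset [OF _ finite_zeros_H]) (auto simp: Z0_def Z_zero)
  \<comment> \<open>The labels of the edges leaving \<open>y\<close>.\<close>
  define E where "E y = {l \<in> L. m ((y - of_int l) / a) \<noteq> 0}" for y
  have E_Z: "(y - of_int l) / a \<in> Z" if "y \<in> Z" "l \<in> E y" for y l
    unfolding Z_def
  proof safe
    fix g assume g: "g \<in> G"
    let ?y = "(y - of_int l) / a"
    \<comment> \<open>The shift is chosen so that dividing the shifted point by \<open>a\<close>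
      gives \<open>?y + g\<close>; then \<open>H_step\<close> yields a vanishing product whose mask
      factor equals \<open>m ?y\<close> and is nonzero.\<close>
    have "- of_int l + a ^ 1 * g \<in> G" using g Ints_G by (intro G_add G_mult) auto
    then have "H (y + (- of_int l + a ^ 1 * g)) = 0" using that by (simp add: Z_def)
    moreover have "(y + (- of_int l + a ^ 1 * g)) / a = ?y + g"
      using a by (simp add: field_simps)
    ultimately have "m (?y + g) * H (?y + g) = 0" using H_step by metis
    then show "H (?y + g) = 0" using that(2) m_period [OF g, of ?y] by (simp add: E_def)
  qed
  have fin_E: "finite (E y)" for y using fin_L by (simp add: E_def)
  have inj: "inj_on (\<lambda>(y, l). frac ((y - of_int l) / a)) (Sigma Z0 E)"
  proof (rule inj_onI, clarsimp)
    fix y l y' l'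
    assume y: "y \<in> Z0" "l \<in> E y" "y' \<in> Z0" "l' \<in> E y'"
      and eq: "frac ((y - of_int l) / a) = frac ((y' - of_int l') / a)"
    define k where "k = \<lfloor>(y - of_int l) / a\<rfloor> - \<lfloor>(y' - of_int l') / a\<rfloor>"
    have "(y - of_int l) / a = (y' - of_int l') / a + of_int k"
      using eq unfolding frac_def k_def by simp
    then have "y - of_int l = ((y' - of_int l') / a + of_int k) * a"
      using a by (metis nonzero_eq_divide_eq)
    then have "y - of_int l = y' - of_int l' + of_int k * a"
      using a by (simp add: distrib_right)
    then have d: "y - y' = of_int (l - l' + A * k)"
      by (simp add: mult.commute)
    \<comment> \<open>An integer of modulus below 1 is 0: the sources agree, and the labels are
      congruent modulo \<open>A\<close>.\<close>
    have "\<bar>y - y'\<bar> < 1" using y by (auto simp: Z0_def)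
    then have "l - l' + A * k = 0" unfolding d by linarith
    then have "y = y'" using d by simp
    moreover have "l - l' = A * (- k)"
      using \<open>l - l' + A * k = 0\<close> by simp
    then have "of_int l - of_int l' = a * of_int (- k)"
      by (metis of_int_diff of_int_mult)
    then have "l = l'" using y by (intro L_cong_eq [of l l' "- k"]) (auto simp: E_def)
    ultimately show "y = y' \<and> l = l'" by simp
  qed
  have "(\<Sum>y\<in>Z0. card (E y)) = card (Sigma Z0 E)"
    using \<open>finite Z0\<close> fin_E by simp
  also have "\<dots> \<le> card Z0"
  proof (rule card_inj_on_le [OF inj _ \<open>finite Z0\<close>], clarify)
    fix y l assume "y \<in> Z0" "l \<in> E y"
    then show "frac ((y - of_int l) / a) \<in> Z0" by (intro frac_Z0 E_Z) (simp add: Z0_def)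
  qed
  finally have le: "(\<Sum>y\<in>Z0. card (E y)) \<le> card Z0" .
  have ge: "card (E y) \<ge> 1" for y
  proof (rule ccontr)
    assume "\<not> ?thesis"
    then have "card (E y) = 0" by linarith
    then have "E y = {}" using fin_E [of y] by simp
    then have "(\<Sum>l\<in>L. (norm (m ((y - of_int l) / a)))\<^sup>2) = 0" by (simp add: E_def)
    then show False using norm_sum_hadamard by simp
  qed
  have "\<exists>y\<in>Z0. card (E y) = 1"
  proof (rule ccontr)
    assume "\<not> ?thesis"
    then have "2 \<le> card (E y)" if "y \<in> Z0" for y using ge [of y] that by force
    then have "(\<Sum>y\<in>Z0. 2) \<le> (\<Sum>y\<in>Z0. card (E y))" by (intro sum_mono) auto
    moreover have "card Z0 > 0" using \<open>Z0 \<noteq> {}\<close> \<open>finite Z0\<close> by (simp add: card_gt_0_iff)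
    ultimately show False using le by simp
  qed
  then obtain y l where y: "y \<in> Z0" "E y = {l}" by (auto simp: card_1_singleton_iff)
  let ?y = "(y - of_int l) / a"
  have "(\<Sum>i\<in>L. (norm (m ((y - of_int i) / a)))\<^sup>2) = (\<Sum>i\<in>E y. (norm (m ((y - of_int i) / a)))\<^sup>2)"
    by (rule sum.mono_neutral_right [OF fin_L]) (auto simp: E_def)
  then have "(norm (m ?y))\<^sup>2 = 1" using norm_sum_hadamard [of y] y by simp
  then have "norm (m ?y) = 1" by (metis norm_ge_zero power_one power2_eq_imp_eq zero_le_one)
  then have "?y \<in> G" using mask_norm_1 [OF fin_B zero_B] unfolding G_def by blast
  moreover have "?y \<in> Z" using E_Z y by (auto simp: Z0_def)
  ultimately have "H (?y + (- ?y)) = 0" using G_minus unfolding Z_def by blast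
  then show False by simp
qed

text \<open>Integers lie in \<open>G\<close>, so only \<open>x\<close> in the unit interval matters.
  Points with ever worse bounds accumulate at some \<open>x\<close>; a single \<open>g\<close> with
  \<open>H (x + g)\<close> nonzero contradicts continuity there.\<close>

lemma equi_positive: "\<exists>\<epsilon>>0. \<epsilon> < 1 \<and> (\<forall>x. \<exists>g\<in>G. \<epsilon> \<le> norm (H (x + g)))"
proof (rule ccontr)
  assume neg: "\<not> ?thesis"
  \<comment> \<open>Two successors keep the candidate bound strictly below 1, also at
    \<open>n = 0\<close>, as the negated claim requires.\<close>
  have "\<exists>x\<in>{0..1}. \<forall>g\<in>G. norm (H (x + g)) < 1 / real (Suc (Suc n))" for n
  proof -
    obtain x where x: "\<And>g. g \<in> G \<Longrightarrow> norm (H (x + g)) < 1 / real (Suc (Suc n))"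
      using neg [simplified, rule_format, of "1 / real (Suc (Suc n))"] by (auto simp: not_le)
    have "norm (H (frac x + g)) < 1 / real (Suc (Suc n))" if "g \<in> G" for g
    proof -
      have "- of_int \<lfloor>x\<rfloor> + g \<in> G" using that Ints_G by (intro G_add) auto
      from x [OF this] show ?thesis by (simp add: frac_def algebra_simps)
    qed
    moreover have "frac x \<in> {0..1}" using frac_lt_1 [of x] by auto
    ultimately show ?thesis by blast
  qed
  then obtain X where X: "\<And>n. X n \<in> {0..1}"
    "\<And>n g. g \<in> G \<Longrightarrow> norm (H (X n + g)) < 1 / real (Suc (Suc n))" by metis
  obtain x r where r: "strict_mono r" "(X \<circ> r) \<longlonglongrightarrow> x"
    using compact_Icc [of "0::real" 1] X(1) unfolding compact_def by metis
  obtain g where g: "g \<in> G" "H (x + g) \<noteq> 0" using no_periodic_zero by blast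
  have "(\<lambda>n. norm (H ((X \<circ> r) n + g))) \<longlonglongrightarrow> norm (H (x + g))"
    by (intro tendsto_norm isCont_tendsto_compose [OF H_cont] tendsto_intros r)
  moreover have "(\<lambda>n. norm (H ((X \<circ> r) n + g))) \<longlonglongrightarrow> 0"
  proof (rule Lim_null_comparison)
    show "\<forall>\<^sub>F n in sequentially. norm (norm (H ((X \<circ> r) n + g))) \<le> 1 / real (Suc n)"
    proof (rule always_eventually, rule allI)
      fix n
      have "norm (H (X (r n) + g)) < 1 / real (Suc (Suc (r n)))" using X(2) g by blast
      also have "\<dots> \<le> 1 / real (Suc n)"
        using seq_suble [OF r(1), of n] by (simp add: frac_le)
      finally show "norm (norm (H ((X \<circ> r) n + g))) \<le> 1 / real (Suc n)" by simp
    qed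
    show "(\<lambda>n. 1 / real (Suc n)) \<longlonglongrightarrow> 0" by real_asymp
  qed
  ultimately show False using g(2) LIMSEQ_unique by fastforce
qed

text \<open>Old frequencies are not shifted: for them \<open>- l / a ^ (n + k)\<close> tends to 0,
  so the modulus of \<open>H\<close> exceeds \<open>\<epsilon> < 1\<close> once \<open>k\<close> is
  large. Every other frequency gets its own shift. The same \<open>\<epsilon>\<close> thus works at
  all stages.\<close>

lemma tight_extend:
  assumes \<epsilon>: "\<epsilon> < 1" "\<And>x. \<exists>g\<in>G. \<epsilon> \<le> norm (H (x + g))"
    and \<Lambda>: "tight n \<Lambda>"
  shows "\<exists>n' \<Lambda>'. n < n' \<and> \<Lambda> \<subseteq> \<Lambda>' \<and> tight n' \<Lambda>' \<and> (\<forall>l\<in>\<Lambda>'. \<epsilon> \<le> norm (H (- l / a ^ n')))"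
proof -
  have "\<forall>\<^sub>F k in sequentially. \<forall>l\<in>\<Lambda>. \<epsilon> < norm (H (- l / a ^ (n + k)))"
  proof (rule eventually_ball_finite)
    show "finite \<Lambda>" using \<Lambda> by (simp add: tight_def)
    show "\<forall>l\<in>\<Lambda>. \<forall>\<^sub>F k in sequentially. \<epsilon> < norm (H (- l / a ^ (n + k)))"
    proof
      fix l
      have "(\<lambda>k. norm (H (- l / a ^ (k + n)))) \<longlonglongrightarrow> norm (1::complex)"
        by (intro tendsto_norm LIMSEQ_ignore_initial_segment [OF H_div_tendsto])
      then show "\<forall>\<^sub>F k in sequentially. \<epsilon> < norm (H (- l / a ^ (n + k)))"
        using \<epsilon>(1) by (intro order_tendstoD) (auto simp: add.commute)
    qed
  qed
  then obtain k0 where "\<And>k. k \<ge> k0 \<Longrightarrow> \<forall>l\<in>\<Lambda>. \<epsilon> < norm (H (- l / a ^ (n + k)))"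
    unfolding eventually_sequentially by blast
  \<comment> \<open>The successor guarantees \<open>k > 0\<close>, so that the level strictly
    increases.\<close>
  from this [of "Suc k0"] have "\<forall>l\<in>\<Lambda>. \<epsilon> < norm (H (- l / a ^ (n + Suc k0)))" by simp
  then obtain k where k: "k > 0" "\<And>l. l \<in> \<Lambda> \<Longrightarrow> \<epsilon> < norm (H (- l / a ^ (n + k)))"
    by (metis zero_less_Suc)
  obtain \<Lambda>' where \<Lambda>': "tight k \<Lambda>'" "0 \<in> \<Lambda>'" using tight_exists by blast
  obtain g where g: "\<And>x. g x \<in> G" "\<And>x. \<epsilon> \<le> norm (H (x + g x))" using \<epsilon>(2) by metis
  \<comment> \<open>The value 0 at \<open>l' = 0\<close> keeps \<open>\<Lambda>\<close> inside the
    new set. The minus sign cancels the one in \<open>- l / a ^ n'\<close>, where \<open>H\<close>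
    is evaluated.\<close>
  define h where "h l l' = (if l' = 0 then 0 else - g (- (l + a ^ n * l') / a ^ (n + k)))" for l l'
  define f where "f = (\<lambda>(l, l'). l + a ^ n * (l' + a ^ k * h l l'))"
  have "tight (n + k) (f ` (\<Lambda> \<times> \<Lambda>'))"
    unfolding f_def by (rule tight_compose [OF \<Lambda> \<Lambda>'(1)]) (use g Ints_G in \<open>auto simp: h_def G_minus\<close>)
  moreover have "\<Lambda> \<subseteq> f ` (\<Lambda> \<times> \<Lambda>')"
    using \<Lambda>'(2) by (force simp: f_def h_def image_iff)
  moreover have "\<epsilon> \<le> norm (H (- f (l, l') / a ^ (n + k)))" if "l \<in> \<Lambda>" for l l'
  proof (cases "l' = 0")
    case True
    then show ?thesis using k(2) [OF that] by (simp add: f_def h_def)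
  next
    case False
    let ?x = "- (l + a ^ n * l') / a ^ (n + k)"
    have "- f (l, l') / a ^ (n + k) = ?x + g ?x"
      using False a by (simp add: f_def h_def field_simps power_add)
    then show ?thesis using g(2) [of ?x] by simp
  qed
  ultimately show ?thesis using k(1)
    by (intro exI [of _ "n + k"] exI [of _ "f ` (\<Lambda> \<times> \<Lambda>')"]) auto
qed

lemma tight_sequence:
  "\<exists>\<epsilon>>0. \<exists>N \<Lambda>. strict_mono N \<and> (\<forall>j. \<Lambda> j \<subseteq> \<Lambda> (Suc j) \<and> tight (N j) (\<Lambda> j) \<and>
     (\<forall>l\<in>\<Lambda> j. \<epsilon> \<le> norm (H (- l / a ^ N j))))"
proof -
  obtain \<epsilon> where \<epsilon>: "\<epsilon> > 0" "\<epsilon> < 1" "\<And>x. \<exists>g\<in>G. \<epsilon> \<le> norm (H (x + g))"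
    using equi_positive by blast
  define P where "P p \<longleftrightarrow> tight (fst p) (snd p) \<and> (\<forall>l\<in>snd p. \<epsilon> \<le> norm (H (- l / a ^ fst p)))"
    for p
  have "\<exists>F. \<forall>j. P (F j) \<and> fst (F j) < fst (F (Suc j)) \<and> snd (F j) \<subseteq> snd (F (Suc j))"
  proof (rule dependent_nat_choice [where P = "\<lambda>_. P" and Q = "\<lambda>_ p q. fst p < fst q \<and> snd p \<subseteq> snd q"])
    show "\<exists>p. P p" using tight_0 \<epsilon> by (intro exI [of _ "(0, {0})"]) (auto simp: P_def)
    show "\<exists>q. P q \<and> fst p < fst q \<and> snd p \<subseteq> snd q" if "P p" for p
      using tight_extend [OF \<epsilon>(2,3), of "fst p" "snd p"] that unfolding P_def by force
  qed
  then obtain F where "\<And>j. P (F j) \<and> fst (F j) < fst (F (Suc j)) \<and> snd (F j) \<subseteq> snd (F (Suc j))"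
    by blast
  then show ?thesis using \<epsilon>(1)
    by (intro exI [of _ \<epsilon>] exI [of _ "fst \<circ> F"] exI [of _ "snd \<circ> F"] conjI)
       (auto simp: P_def strict_mono_Suc_iff)
qed

end

section \<open>Trigonometric polynomials in \<open>L\<^sup>2\<close>\<close>

lemma continuous_on_expo [continuous_intros]: "continuous_on S (expo t)"
  unfolding expo_def by (intro continuous_intros)

lemma borel_measurable_expo [measurable]: "expo t \<in> borel_measurable borel"
  by (intro borel_measurable_continuous_onI continuous_on_expo)

lemma norm_expo_diff_le: "norm (expo (s + u) x - expo s x) \<le> 2 * pi * \<bar>u\<bar> * \<bar>x\<bar>"
proof -
  have "expo u x = iexp (2 * pi * u * x)" by (simp add: expo_def mult_ac)
  then have "norm (expo u x - 1) \<le> \<bar>2 * pi * u * x\<bar>"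
    using iexp_approx1 [of "2 * pi * u * x" 0] by simp
  moreover have "expo (s + u) x - expo s x = expo s x * (expo u x - 1)"
    by (simp add: expo_add algebra_simps)
  ultimately show ?thesis by (simp add: norm_mult abs_mult)
qed

definition trig_span :: "real set \<Rightarrow> (real \<Rightarrow> complex) set" where
  "trig_span \<Lambda> = {f. \<exists>F c. finite F \<and> F \<subseteq> \<Lambda> \<and> f = (\<lambda>x. \<Sum>t\<in>F. c t * expo t x)}"

lemma trig_span_sum:
  assumes "finite F" "F \<subseteq> \<Lambda>"
  shows "(\<lambda>x. \<Sum>t\<in>F. c t * expo t x) \<in> trig_span \<Lambda>"
  using assms by (auto simp: trig_span_def)

lemma trig_span_cmult:
  assumes "f \<in> trig_span \<Lambda>"
  shows "(\<lambda>x. k * f x) \<in> trig_span \<Lambda>"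
proof -
  obtain F c where F: "finite F" "F \<subseteq> \<Lambda>" "f = (\<lambda>x. \<Sum>t\<in>F. c t * expo t x)"
    using assms by (auto simp: trig_span_def)
  then show ?thesis
    using trig_span_sum [OF F(1,2), of "\<lambda>t. k * c t"] by (simp add: sum_distrib_left mult.assoc)
qed

lemma trig_span_add:
  assumes "f \<in> trig_span \<Lambda>" "g \<in> trig_span \<Lambda>"
  shows "(\<lambda>x. f x + g x) \<in> trig_span \<Lambda>"
proof -
  obtain F c where F: "finite F" "F \<subseteq> \<Lambda>" "f = (\<lambda>x. \<Sum>t\<in>F. c t * expo t x)"
    using assms by (auto simp: trig_span_def)
  obtain F' c' where F': "finite F'" "F' \<subseteq> \<Lambda>" "g = (\<lambda>x. \<Sum>t\<in>F'. c' t * expo t x)"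
    using assms by (auto simp: trig_span_def)
  define d where "d t = (if t \<in> F then c t else 0) + (if t \<in> F' then c' t else 0)" for t
  have f: "f x = (\<Sum>t\<in>F\<union>F'. (if t \<in> F then c t else 0) * expo t x)" for x
    unfolding F(3) by (rule sum.mono_neutral_cong_left) (use F F' in auto)
  have g: "g x = (\<Sum>t\<in>F\<union>F'. (if t \<in> F' then c' t else 0) * expo t x)" for x
    unfolding F'(3) by (rule sum.mono_neutral_cong_left) (use F F' in auto)
  have "(\<lambda>x. f x + g x) = (\<lambda>x. \<Sum>t\<in>F\<union>F'. d t * expo t x)"
    unfolding f g by (simp add: d_def sum.distrib [symmetric] distrib_right)
  then show ?thesis using trig_span_sum [of "F \<union> F'" \<Lambda> d] F F' by simp
qed

lemma trig_span_diff:
  assumes "f \<in> trig_span \<Lambda>" "g \<in> trig_span \<Lambda>"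
  shows "(\<lambda>x. f x - g x) \<in> trig_span \<Lambda>"
  using trig_span_add [OF assms(1) trig_span_cmult [OF assms(2), of "-1"]] by simp

lemma trig_span_mono: "f \<in> trig_span \<Lambda> \<Longrightarrow> \<Lambda> \<subseteq> \<Lambda>' \<Longrightarrow> f \<in> trig_span \<Lambda>'"
  unfolding trig_span_def by blast

lemma trig_span_zero: "(\<lambda>x. 0) \<in> trig_span \<Lambda>"
  using trig_span_sum [of "{}" \<Lambda>] by simp

lemma trig_span_expo: "t \<in> \<Lambda> \<Longrightarrow> expo t \<in> trig_span \<Lambda>"
  using trig_span_sum [of "{t}" \<Lambda> "\<lambda>_. 1"] by simp

lemma trig_span_const: "(\<lambda>x. k) \<in> trig_span UNIV"
  using trig_span_cmult [OF trig_span_expo [of 0 UNIV], of k] by simp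

lemma trig_span_mult:
  assumes "f \<in> trig_span UNIV" "g \<in> trig_span UNIV"
  shows "(\<lambda>x. f x * g x) \<in> trig_span UNIV"
proof -
  have 1: "(\<lambda>x. expo s x * g x) \<in> trig_span UNIV" if g: "g \<in> trig_span UNIV" for s g
  proof -
    obtain F c where F: "finite F" "g = (\<lambda>x. \<Sum>t\<in>F. c t * expo t x)"
      using g by (auto simp: trig_span_def)
    have "(\<lambda>x. expo s x * g x) = (\<lambda>x. \<Sum>t\<in>(+) s ` F. c (t - s) * expo t x)"
      unfolding F(2) by (subst sum.reindex) (simp_all add: expo_add sum_distrib_left mult_ac)
    then show ?thesis using trig_span_sum [of "(+) s ` F" UNIV "\<lambda>t. c (t - s)"] F by simp
  qed
  obtain F c where F: "finite F" "f = (\<lambda>x. \<Sum>t\<in>F. c t * expo t x)"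
    using assms(1) by (auto simp: trig_span_def)
  have "(\<lambda>x. (\<Sum>t\<in>F. c t * expo t x) * g x) \<in> trig_span UNIV"
    using F(1)
  proof induction
    case empty
    then show ?case by (simp add: trig_span_zero)
  next
    case (insert s F)
    then show ?case
      using trig_span_add [OF trig_span_cmult [OF 1 [OF assms(2), of s], of "c s"] insert.IH]
      by (simp add: distrib_right mult.assoc)
  qed
  then show ?thesis by (simp add: F)
qed

lemma trig_span_continuous:
  assumes "f \<in> trig_span \<Lambda>"
  shows "continuous_on S f"
  using assms by (auto simp: trig_span_def intro!: continuous_intros)

lemma trig_span_measurable:
  assumes "f \<in> trig_span \<Lambda>"
  shows "f \<in> borel_measurable borel"
  by (intro borel_measurable_continuous_onI trig_span_continuous [OF assms])

lemma trig_span_bounded: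
  assumes "f \<in> trig_span \<Lambda>"
  shows "\<exists>K. \<forall>x. norm (f x) \<le> K"
proof -
  obtain F c where F: "f = (\<lambda>x. \<Sum>t\<in>F. c t * expo t x)"
    using assms by (auto simp: trig_span_def)
  have "norm (f x) \<le> (\<Sum>t\<in>F. norm (c t))" for x
    unfolding F by (rule sum_norm_le) (simp add: norm_mult)
  then show ?thesis by blast
qed

text \<open>Stone--Weierstrass: the real-valued functions in the span of all characters form an algebra
  which separates points.\<close>

lemma trig_span_dense_continuous:
  fixes g :: "real \<Rightarrow> real"
  assumes "continuous_on UNIV g" "e > 0"
  shows "\<exists>p\<in>trig_span UNIV. \<forall>x\<in>{-R..R}. norm (of_real (g x) - p x) < e"
proof -
  define P where "P h \<longleftrightarrow> (\<lambda>x::real. complex_of_real (h x)) \<in> trig_span UNIV" for h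
  have re: "P (\<lambda>x. Re (expo t x))" for t
    using trig_span_cmult [OF trig_span_add [OF trig_span_expo [of t] trig_span_expo [of "- t"]], of UNIV "1/2"]
    by (simp add: P_def expo_minus complex_add_cnj)
  have im: "P (\<lambda>x. Im (expo t x))" for t
    using trig_span_cmult [OF trig_span_diff [OF trig_span_expo [of t] trig_span_expo [of "- t"]], of UNIV "1/(2*\<i>)"]
    by (simp add: P_def expo_minus complex_diff_cnj mult.assoc [symmetric] mult.commute [of _ \<i>])
  have "\<exists>h. P h \<and> (\<forall>x\<in>{-R..R}. \<bar>g x - h x\<bar> < e)"
  proof (rule Stone_Weierstrass_HOL)
    show "P (\<lambda>x. c)" for c by (simp add: P_def trig_span_const)
    show "continuous_on {-R..R} f" if "P f" for f
    proof -
      have "continuous_on {-R..R} (\<lambda>x. Re (complex_of_real (f x)))"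
        using that unfolding P_def by (intro continuous_intros trig_span_continuous)
      then show ?thesis by simp
    qed
    show "P (\<lambda>x. f x + g x)" if "P f \<and> P g" for f g
      using that trig_span_add by (auto simp: P_def)
    show "P (\<lambda>x. f x * g x)" if "P f \<and> P g" for f g
      using that trig_span_mult by (auto simp: P_def)
    show "\<exists>f. P f \<and> f x \<noteq> f y" if "x \<in> {-R..R} \<and> y \<in> {-R..R} \<and> x \<noteq> y" for x y
    proof (rule ccontr)
      assume *: "\<not> ?thesis"
      \<comment> \<open>With this frequency the characters at \<open>x\<close> and \<open>y\<close>
        differ by the factor -1.\<close>
      define t where "t = 1 / (2 * (x - y))"
      have "expo t x = expo t y" using * re im by (metis complex_eqI)
      moreover have "expo t x = expo t (x - y) * expo t y"
        by (simp add: expo_def exp_add [symmetric] algebra_simps)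
      moreover have "expo t y \<noteq> 0" using norm_expo [of t y] by fastforce
      ultimately have "t * (x - y) \<in> \<int>" by (simp add: expo_eq_1_iff)
      moreover have "t * (x - y) = 1/2" using that by (simp add: t_def)
      ultimately have "(1/2 :: real) \<in> \<int>" by simp
      then obtain k :: int where "(1/2 :: real) = of_int k" by (auto elim: Ints_cases)
      then have "2 * k = 1" by linarith
      then show False by presburger
    qed
    show "continuous_on {-R..R} g" using assms(1) continuous_on_subset by blast
  qed (use assms in auto)
  then obtain h where h: "P h" "\<forall>x\<in>{-R..R}. \<bar>g x - h x\<bar> < e" by blast
  have "norm (complex_of_real (g x) - complex_of_real (h x)) = \<bar>g x - h x\<bar>" for x
    by (metis norm_of_real of_real_diff)
  then show ?thesis using h by (intro bexI [of _ "\<lambda>x. of_real (h x)"]) (auto simp: P_def)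
qed

text \<open>Squared norms avoid square roots in the estimates; the bound
  \<open>2 * nsq M f + 2 * nsq M g\<close> for a sum takes the place of the triangle
  inequality.\<close>

definition nsq :: "real measure \<Rightarrow> (real \<Rightarrow> complex) \<Rightarrow> real" where
  "nsq M f = (LINT x|M. (norm (f x))\<^sup>2)"

lemma nsq_nonneg: "nsq M f \<ge> 0"
  by (simp add: nsq_def)

lemma L2_norm_less_iff: "e > 0 \<Longrightarrow> L2_norm M f < e \<longleftrightarrow> nsq M f < e\<^sup>2"
  using real_sqrt_less_iff [of "nsq M f" "e\<^sup>2"] by (simp add: L2_norm_def nsq_def)

lemma norm_add_squared_le:
  fixes x y :: "'a::real_normed_vector"
  shows "(norm (x + y))\<^sup>2 \<le> 2 * (norm x)\<^sup>2 + 2 * (norm y)\<^sup>2"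
proof -
  have "(norm (x + y))\<^sup>2 \<le> (norm x + norm y)\<^sup>2"
    by (simp add: norm_triangle_ineq power_mono)
  also have "\<dots> \<le> 2 * (norm x)\<^sup>2 + 2 * (norm y)\<^sup>2"
    using sum_squares_bound [of "norm x" "norm y"] by (simp add: power2_sum)
  finally show ?thesis .
qed

section \<open>Density of the trigonometric polynomials for a probability measure of bounded
  support\<close>

context real_distribution
begin

lemma prob_UNIV [simp]: "prob UNIV = 1"
  using prob_space by simp

lemma integrable_bounded:
  fixes f :: "real \<Rightarrow> 'a::{banach, second_countable_topology}"
  assumes "f \<in> borel_measurable borel" "\<And>x. norm (f x) \<le> K"
  shows "integrable M f"
  by (rule integrable_const_bound [of _ K]) (use assms in auto)

lemma square_integrable_bounded:
  assumes "f \<in> borel_measurable borel" "\<And>x. norm (f x) \<le> K"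
  shows "square_integrable M f"
proof -
  have [measurable]: "f \<in> borel_measurable borel" by fact
  have "(norm (f x))\<^sup>2 \<le> K\<^sup>2" for x using assms(2) [of x] by (intro power_mono) auto
  then have "integrable M (\<lambda>x. (norm (f x))\<^sup>2)"
    by (intro integrable_bounded [of _ "K\<^sup>2"]) auto
  then show ?thesis by (simp add: square_integrable_def)
qed

lemma square_integrable_trig_span:
  assumes "f \<in> trig_span \<Lambda>"
  shows "square_integrable M f"
proof -
  obtain K where "\<And>x. norm (f x) \<le> K" using trig_span_bounded [OF assms] by blast
  then show ?thesis by (rule square_integrable_bounded [OF trig_span_measurable [OF assms]])
qed

lemma square_integrable_add:
  assumes "square_integrable M f" "square_integrable M g"
  shows "square_integrable M (\<lambda>x. f x + g x)"
proof -
  have [measurable]: "f \<in> borel_measurable M" "g \<in> borel_measurable M"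
    using assms by (auto simp: square_integrable_def)
  have "integrable M (\<lambda>x. (norm (f x + g x))\<^sup>2)"
  proof (rule Bochner_Integration.integrable_bound)
    show "integrable M (\<lambda>x. 2 * (norm (f x))\<^sup>2 + 2 * (norm (g x))\<^sup>2)"
      using assms by (simp add: square_integrable_def)
    show "AE x in M. norm ((norm (f x + g x))\<^sup>2) \<le> norm (2 * (norm (f x))\<^sup>2 + 2 * (norm (g x))\<^sup>2)"
      using norm_add_squared_le by (intro AE_I2) auto
  qed measurable
  then show ?thesis by (simp add: square_integrable_def)
qed

lemma square_integrable_cmult:
  assumes "square_integrable M f"
  shows "square_integrable M (\<lambda>x. k * f x)"
  using assms by (auto simp: square_integrable_def norm_mult power_mult_distrib)

lemma square_integrable_diff:
  assumes "square_integrable M f" "square_integrable M g"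
  shows "square_integrable M (\<lambda>x. f x - g x)"
  using square_integrable_add [OF assms(1) square_integrable_cmult [OF assms(2), of "-1"]] by simp

lemma nsq_add_le:
  assumes "square_integrable M f" "square_integrable M g"
  shows "nsq M (\<lambda>x. f x + g x) \<le> 2 * nsq M f + 2 * nsq M g"
proof -
  have "nsq M (\<lambda>x. f x + g x) \<le> (LINT x|M. 2 * (norm (f x))\<^sup>2 + 2 * (norm (g x))\<^sup>2)"
    unfolding nsq_def using assms square_integrable_add [OF assms]
    by (intro integral_mono norm_add_squared_le) (auto simp: square_integrable_def)
  also have "\<dots> = 2 * nsq M f + 2 * nsq M g"
    unfolding nsq_def using assms by (simp add: square_integrable_def)
  finally show ?thesis .
qed

text \<open>A linear space closed under dominated limits, so that membership can be lifted from
  continuous functions to half-lines, Borel sets, simple functions and finally all square-integrable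
  functions.\<close>

definition trig_closure :: "(real \<Rightarrow> complex) set" where
  "trig_closure = {f. square_integrable M f \<and>
     (\<forall>e>0. \<exists>p\<in>trig_span UNIV. nsq M (\<lambda>x. f x - p x) < e)}"

lemma trig_closureD:
  assumes "f \<in> trig_closure" "e > 0"
  obtains p where "p \<in> trig_span UNIV" "nsq M (\<lambda>x. f x - p x) < e"
  using assms unfolding trig_closure_def by blast

lemma trig_closure_add:
  assumes "f \<in> trig_closure" "g \<in> trig_closure"
  shows "(\<lambda>x. f x + g x) \<in> trig_closure"
proof -
  have "\<exists>r\<in>trig_span UNIV. nsq M (\<lambda>x. f x + g x - r x) < e" if "e > 0" for e
  proof -
    have e4: "e / 4 > 0" using \<open>e > 0\<close> by simp
    obtain p where p: "p \<in> trig_span UNIV" "nsq M (\<lambda>x. f x - p x) < e / 4"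
      by (rule trig_closureD [OF assms(1) e4])
    obtain q where q: "q \<in> trig_span UNIV" "nsq M (\<lambda>x. g x - q x) < e / 4"
      by (rule trig_closureD [OF assms(2) e4])
    have "nsq M (\<lambda>x. (f x - p x) + (g x - q x)) \<le> 2 * nsq M (\<lambda>x. f x - p x) + 2 * nsq M (\<lambda>x. g x - q x)"
      using assms p q
      by (intro nsq_add_le square_integrable_diff) (auto simp: trig_closure_def intro: square_integrable_trig_span)
    then show ?thesis using p q
      by (intro bexI [OF _ trig_span_add [OF p(1) q(1)]]) (simp add: algebra_simps)
  qed
  then show ?thesis using assms by (auto simp: trig_closure_def square_integrable_add)
qed

lemma trig_closure_closed:
  assumes "square_integrable M f" "\<And>e. e > 0 \<Longrightarrow> \<exists>g\<in>trig_closure. nsq M (\<lambda>x. f x - g x) < e"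
  shows "f \<in> trig_closure"
proof -
  have "\<exists>p\<in>trig_span UNIV. nsq M (\<lambda>x. f x - p x) < e" if "e > 0" for e
  proof -
    obtain g where g: "g \<in> trig_closure" "nsq M (\<lambda>x. f x - g x) < e / 4"
      using assms(2) [of "e/4"] \<open>e > 0\<close> by auto
    have "e / 4 > 0" using \<open>e > 0\<close> by simp
    then obtain p where p: "p \<in> trig_span UNIV" "nsq M (\<lambda>x. g x - p x) < e / 4"
      by (rule trig_closureD [OF g(1)])
    have "nsq M (\<lambda>x. (f x - g x) + (g x - p x)) \<le> 2 * nsq M (\<lambda>x. f x - g x) + 2 * nsq M (\<lambda>x. g x - p x)"
      using assms g p
      by (intro nsq_add_le square_integrable_diff) (auto simp: trig_closure_def intro: square_integrable_trig_span)
    then show ?thesis using p g by (intro bexI [OF _ p(1)]) simp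
  qed
  then show ?thesis using assms by (auto simp: trig_closure_def)
qed

lemma trig_span_closure: "f \<in> trig_span UNIV \<Longrightarrow> f \<in> trig_closure"
  unfolding trig_closure_def
  by (auto simp: square_integrable_trig_span intro!: bexI [of _ f] simp: nsq_def)

lemma nsq_cmult: "nsq M (\<lambda>x. k * f x) = (norm k)\<^sup>2 * nsq M f"
  by (simp add: nsq_def norm_mult power_mult_distrib)

lemma trig_closure_cmult:
  assumes "f \<in> trig_closure"
  shows "(\<lambda>x. k * f x) \<in> trig_closure"
proof (cases "k = 0")
  case True
  then show ?thesis using trig_span_closure [OF trig_span_zero] by simp
next
  case False
  have "\<exists>p\<in>trig_span UNIV. nsq M (\<lambda>x. k * f x - p x) < e" if "e > 0" for e
  proof -
    have "e / (norm k)\<^sup>2 > 0" using \<open>e > 0\<close> False by simp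
    then obtain p where p: "p \<in> trig_span UNIV" "nsq M (\<lambda>x. f x - p x) < e / (norm k)\<^sup>2"
      by (rule trig_closureD [OF assms])
    have "nsq M (\<lambda>x. k * f x - k * p x) = (norm k)\<^sup>2 * nsq M (\<lambda>x. f x - p x)"
      by (simp add: nsq_cmult [symmetric] right_diff_distrib)
    also have "\<dots> < e" using p False by (simp add: pos_less_divide_eq mult.commute)
    finally show ?thesis using trig_span_cmult [OF p(1), of k] by (intro bexI)
  qed
  then show ?thesis using assms by (auto simp: trig_closure_def square_integrable_cmult)
qed

lemma trig_closure_sum:
  assumes "finite I" "\<And>i. i \<in> I \<Longrightarrow> f i \<in> trig_closure"
  shows "(\<lambda>x. \<Sum>i\<in>I. f i x) \<in> trig_closure"
  using assms
proof (induction rule: finite_induct)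
  case empty
  then show ?case using trig_span_closure [OF trig_span_zero] by simp
next
  case (insert i I)
  then show ?case using trig_closure_add [of "f i" "\<lambda>x. \<Sum>i\<in>I. f i x"] by simp
qed

lemma trig_closure_limit:
  assumes f: "\<And>n. f n \<in> trig_closure" and g: "g \<in> borel_measurable M"
    and lim: "\<And>x. (\<lambda>n. f n x) \<longlonglongrightarrow> g x"
    and w: "integrable M w" "\<And>n x. (norm (f n x))\<^sup>2 \<le> w x"
  shows "g \<in> trig_closure"
proof -
  have fm [measurable]: "f n \<in> borel_measurable M" for n
    using f by (auto simp: trig_closure_def square_integrable_def)
  note [measurable] = g
  have gw: "(norm (g x))\<^sup>2 \<le> w x" for x
  proof (rule LIMSEQ_le_const2)
    show "(\<lambda>n. (norm (f n x))\<^sup>2) \<longlonglongrightarrow> (norm (g x))\<^sup>2"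
      by (intro tendsto_intros lim)
  qed (use w in auto)
  have "integrable M (\<lambda>x. (norm (g x))\<^sup>2)"
    by (rule Bochner_Integration.integrable_bound [OF w(1)])
       (use gw in \<open>auto intro!: AE_I2 order_trans [OF gw abs_ge_self]\<close>)
  then have sq: "square_integrable M g" by (simp add: square_integrable_def)
  have "(\<lambda>n. nsq M (\<lambda>x. g x - f n x)) \<longlonglongrightarrow> (LINT x|M. 0)"
    unfolding nsq_def
  \<comment> \<open>The limit inherits the bound \<open>w\<close>, and the squared modulus of a
    difference is at most twice the sum of the squared moduli, whence the factor 4.\<close>
  proof (rule integral_dominated_convergence [where w = "\<lambda>x. 4 * w x"])
    show "AE x in M. (\<lambda>n. (norm (g x - f n x))\<^sup>2) \<longlonglongrightarrow> 0"
    proof (rule AE_I2)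
      fix x
      have "(\<lambda>n. (norm (g x - f n x))\<^sup>2) \<longlonglongrightarrow> (norm (g x - g x))\<^sup>2"
        by (intro tendsto_intros lim)
      then show "(\<lambda>n. (norm (g x - f n x))\<^sup>2) \<longlonglongrightarrow> 0" by simp
    qed
    show "AE x in M. norm ((norm (g x - f n x))\<^sup>2) \<le> 4 * w x" for n
    proof (rule AE_I2)
      fix x
      show "norm ((norm (g x - f n x))\<^sup>2) \<le> 4 * w x"
        using norm_add_squared_le [of "g x" "- f n x"] gw [of x] w(2) [of n x] by simp
    qed
  qed (use w in auto)
  then have lim0: "(\<lambda>n. nsq M (\<lambda>x. g x - f n x)) \<longlonglongrightarrow> 0" by simp
  show ?thesis
  proof (rule trig_closure_closed [OF sq])
    fix e :: real assume "e > 0"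
    from order_tendstoD(2) [OF lim0 this] obtain n where "nsq M (\<lambda>x. g x - f n x) < e"
      by (auto simp: eventually_sequentially)
    then show "\<exists>h\<in>trig_closure. nsq M (\<lambda>x. g x - h x) < e" using f by blast
  qed
qed

text \<open>Uniform approximation is available only on a compact interval, which suffices because
  the interval carries the measure. Boundedness of \<open>g\<close> on the whole line gives square
  integrability.\<close>

lemma trig_closure_continuous:
  fixes g :: "real \<Rightarrow> real"
  assumes supp: "AE x in M. \<bar>x\<bar> \<le> R" and g: "continuous_on UNIV g" "\<And>x. \<bar>g x\<bar> \<le> K"
  shows "(\<lambda>x. of_real (g x)) \<in> trig_closure"
proof -
  have [measurable]: "g \<in> borel_measurable borel"
    using g by (intro borel_measurable_continuous_onI)
  have sq: "square_integrable M (\<lambda>x. complex_of_real (g x))"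
    by (rule square_integrable_bounded [of _ K]) (use g in auto)
  have "\<exists>p\<in>trig_span UNIV. nsq M (\<lambda>x. of_real (g x) - p x) < e" if "e > 0" for e
  proof -
    obtain p where p: "p \<in> trig_span UNIV" "\<forall>x\<in>{-R..R}. norm (of_real (g x) - p x) < sqrt (e / 2)"
      using trig_span_dense_continuous [OF g(1), of "sqrt (e/2)" R] \<open>e > 0\<close> by auto
    have "nsq M (\<lambda>x. of_real (g x) - p x) \<le> (LINT x|M. e / 2)"
      unfolding nsq_def
    proof (rule integral_mono_AE)
      show "integrable M (\<lambda>x. (norm (of_real (g x) - p x))\<^sup>2)"
        using square_integrable_diff [OF sq square_integrable_trig_span [OF p(1)]]
        by (simp add: square_integrable_def)
      show "AE x in M. (norm (of_real (g x) - p x))\<^sup>2 \<le> e / 2"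
        using supp
      proof eventually_elim
        case (elim x)
        then have "x \<in> {-R..R}" by auto
        then have "norm (of_real (g x) - p x) < sqrt (e / 2)" using p(2) by blast
        then have "(norm (of_real (g x) - p x))\<^sup>2 \<le> (sqrt (e / 2))\<^sup>2" by (intro power_mono) auto
        then show ?case using \<open>e > 0\<close> by simp
      qed
    qed auto
    also have "\<dots> < e" using \<open>e > 0\<close> by simp
    finally show ?thesis using p(1) by blast
  qed
  then show ?thesis using sq by (auto simp: trig_closure_def)
qed

lemma trig_closure_atMost:
  assumes supp: "AE x in M. \<bar>x\<bar> \<le> R"
  shows "indicator {..c} \<in> trig_closure"
proof -
  \<comment> \<open>For positive \<open>n\<close> a continuous ramp: 1 up to \<open>c\<close>, then
    falling linearly to 0 at \<open>c + 1 / n\<close>.\<close>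
  define g where "g n x = max 0 (min 1 (1 - real n * (x - c)))" for n x
  have "(\<lambda>n. complex_of_real (g n x)) \<longlonglongrightarrow> indicator {..c} x" for x
  proof (cases "x \<le> c")
    case True
    then have "g n x = 1" for n by (simp add: g_def mult_nonneg_nonpos)
    then show ?thesis using True by simp
  next
    case False
    then obtain N :: nat where N: "1 < real N * (x - c)" using ex_less_of_nat_mult [of "x - c" 1] by auto
    have "complex_of_real (g n x) = 0" if "n \<ge> N" for n
    proof -
      have "real N * (x - c) \<le> real n * (x - c)" using that False by (intro mult_right_mono) auto
      then show ?thesis using N by (simp add: g_def)
    qed
    then have "\<forall>\<^sub>F n in sequentially. complex_of_real (g n x) = 0"
      unfolding eventually_sequentially by blast
    then show ?thesis using False by (simp add: tendsto_eventually)
  qed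
  moreover have "\<bar>g n x\<bar> \<le> 1" for n x by (simp add: g_def)
  moreover have "(\<lambda>x. of_real (g n x)) \<in> trig_closure" for n
    by (rule trig_closure_continuous [OF supp, of _ 1]) (auto simp: g_def intro!: continuous_intros)
  moreover have "(norm (complex_of_real (g n x)))\<^sup>2 \<le> 1" for n x
    using \<open>\<And>n x. \<bar>g n x\<bar> \<le> 1\<close> by (simp add: abs_square_le_1)
  ultimately show ?thesis
    by - (rule trig_closure_limit [where f = "\<lambda>n x. of_real (g n x)" and w = "\<lambda>_. 1"], simp_all)
qed

text \<open>Dynkin's argument: half-lines form an intersection-stable generator, complements are
  linear combinations with the constant 1, and disjoint unions are limits of partial sums bounded by
  1.\<close>

lemma trig_closure_indicator:
  assumes supp: "AE x in M. \<bar>x\<bar> \<le> R" and E: "E \<in> sets borel"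
  shows "indicator E \<in> trig_closure"
proof -
  have borel: "sets borel = sigma_sets UNIV (range (\<lambda>c::real. {..c}))"
    unfolding borel_eq_atMost by (rule sets_measure_of) blast
  have E': "E \<in> sigma_sets UNIV (range (\<lambda>c::real. {..c}))" using E borel by simp
  have "Int_stable (range (\<lambda>c::real. {..c}))"
    by (auto simp: Int_stable_def Int_atMost)
  moreover have "range (\<lambda>c::real. {..c}) \<subseteq> Pow UNIV" by blast
  ultimately show ?thesis using E'
  proof (rule sigma_sets_induct_disjoint)
    show "indicator X \<in> trig_closure" if "X \<in> range (\<lambda>c::real. {..c})" for X
      using that trig_closure_atMost [OF supp] by auto
    show "indicator {} \<in> trig_closure"
      using trig_span_closure [OF trig_span_zero] by (simp add: indicator_def [abs_def])
    show "indicator (UNIV - X) \<in> trig_closure" if "indicator X \<in> trig_closure" for X :: "real set"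
    proof -
      have "(indicator (UNIV - X) :: real \<Rightarrow> complex) = (\<lambda>x. 1 + (- 1) * indicator X x)"
        by (auto simp: indicator_def)
      then show ?thesis
        using trig_closure_add [OF trig_span_closure [OF trig_span_const [of 1]] trig_closure_cmult [OF that, of "-1"]]
        by simp
    qed
    fix X :: "nat \<Rightarrow> real set"
    assume dis: "disjoint_family X" and Xs: "range X \<subseteq> sigma_sets UNIV (range (\<lambda>c::real. {..c}))"
      and X: "\<And>i. indicator (X i) \<in> trig_closure"
    have Xb [measurable]: "X i \<in> sets borel" for i using Xs borel by auto
    have s: "(\<Sum>i<n. indicator (X i) x) = (indicator (\<Union>i<n. X i) x :: complex)" for n x
      by (subst indicator_UN_disjoint) (use dis in \<open>auto simp: disjoint_family_on_def\<close>)
    show "indicator (\<Union>i. X i) \<in> trig_closure"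
    proof (rule trig_closure_limit [of "\<lambda>n x. \<Sum>i<n. indicator (X i) x" _ "\<lambda>_. 1"])
      show "(\<lambda>x. \<Sum>i<n. indicator (X i) x) \<in> trig_closure" for n
        using X by (intro trig_closure_sum) auto
      show "(\<lambda>n. \<Sum>i<n. indicator (X i) x) \<longlonglongrightarrow> (indicator (\<Union>i. X i) x :: complex)" for x
        unfolding s by (rule LIMSEQ_indicator_UN)
      show "(norm (\<Sum>i<n. indicator (X i) x :: complex))\<^sup>2 \<le> 1" for n x
        unfolding s by (simp add: indicator_def)
    qed auto
  qed
qed

text \<open>Simple functions converging to \<open>f\<close> can be taken with modulus at most twice
  that of \<open>f\<close>, so four times the squared modulus of \<open>f\<close> is an integrable
  majorant.\<close>

theorem trig_dense:
  assumes supp: "AE x in M. \<bar>x\<bar> \<le> R" and f: "square_integrable M f"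
  shows "f \<in> trig_closure"
proof -
  have fm: "f \<in> borel_measurable M" using f by (simp add: square_integrable_def)
  then obtain F where F: "\<And>i. simple_function M (F i)"
    "\<And>x. x \<in> space M \<Longrightarrow> (\<lambda>i. F i x) \<longlonglongrightarrow> f x"
    "\<And>i x. x \<in> space M \<Longrightarrow> dist (F i x) 0 \<le> 2 * dist (f x) 0"
    using borel_measurable_implies_sequence_metric [OF fm, of 0] by blast
  show ?thesis
  proof (rule trig_closure_limit [of F])
    fix n
    have sf: "F n x = (\<Sum>y\<in>range (F n). y * indicator (F n -` {y}) x)" for x
    proof -
      have fin: "finite (range (F n))" using simple_functionD(1) [OF F(1) [of n]] by simp
      have "(\<Sum>y\<in>range (F n). y * indicator (F n -` {y}) x) = (\<Sum>y\<in>{F n x}. y * indicator (F n -` {y}) x)"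
        by (rule sum.mono_neutral_right [OF fin]) (auto simp: indicator_def)
      then show ?thesis by simp
    qed
    have "(\<lambda>x. \<Sum>y\<in>range (F n). y * indicator (F n -` {y}) x) \<in> trig_closure"
    proof (intro trig_closure_sum trig_closure_cmult trig_closure_indicator [OF supp])
      show "finite (range (F n))" using simple_functionD(1) [OF F(1) [of n]] by simp
      show "F n -` {y} \<in> sets borel" for y
        using simple_functionD(2) [OF F(1) [of n], of "{y}"] by simp
    qed
    moreover have "F n = (\<lambda>x. \<Sum>y\<in>range (F n). y * indicator (F n -` {y}) x)"
      by (rule ext) (rule sf)
    ultimately show "F n \<in> trig_closure" by (rule ssubst [rotated])
    show "(\<lambda>n. F n x) \<longlonglongrightarrow> f x" for x using F(2) by simp
    show "(norm (F n x))\<^sup>2 \<le> 4 * (norm (f x))\<^sup>2" for n x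
    proof -
      have "norm (F n x) \<le> 2 * norm (f x)" using F(3) [of x n] by simp
      then have "(norm (F n x))\<^sup>2 \<le> (2 * norm (f x))\<^sup>2" by (intro power_mono) auto
      then show ?thesis by (simp add: power_mult_distrib)
    qed
  qed (use f in \<open>auto simp: square_integrable_def\<close>)
qed

section \<open>Fourier transforms, orthogonal expansions and completeness of characters\<close>

definition ft :: "real \<Rightarrow> complex" where
  "ft t = (LINT x|M. expo t x)"

lemma ft_0 [simp]: "ft 0 = 1"
  using prob_space by (simp add: ft_def)

lemma L2_inner_expo: "L2_inner M (expo s) (expo t) = ft (s - t)"
  by (simp add: L2_inner_def ft_def expo_diff)

lemma integrable_expo [simp]: "integrable M (\<lambda>x. expo t x)"
  by (rule integrable_bounded [of _ 1]) auto

lemma ft_eq_char: "ft t = char M (2 * pi * t)"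
proof -
  have "expo t x = iexp (2 * pi * t * x)" for x by (simp add: expo_def mult_ac)
  then show ?thesis by (simp add: ft_def char_def)
qed

lemma isCont_ft: "isCont ft t"
proof -
  have "isCont (\<lambda>t. char M (2 * pi * t)) t"
    by (rule isCont_o2 [OF _ isCont_char]) (intro continuous_intros)
  then show ?thesis by (simp add: ft_eq_char [abs_def])
qed

text \<open>Bounded support makes the constant independent of \<open>s\<close>. Uniformity matters
  because the bound is applied at the points \<open>- l / a ^ n\<close>, over which there is no
  control.\<close>

lemma ft_lipschitz:
  assumes supp: "AE x in M. \<bar>x\<bar> \<le> R"
  shows "norm (ft (s + u) - ft s) \<le> 2 * pi * R * \<bar>u\<bar>"
proof -
  have "norm (ft (s + u) - ft s) = norm (LINT x|M. expo (s + u) x - expo s x)"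
    by (simp add: ft_def)
  also have "\<dots> \<le> (LINT x|M. norm (expo (s + u) x - expo s x))"
    by (rule integral_norm_bound)
  also have "\<dots> \<le> (LINT x|M. 2 * pi * R * \<bar>u\<bar>)"
  proof (rule integral_mono_AE)
    show "AE x in M. norm (expo (s + u) x - expo s x) \<le> 2 * pi * R * \<bar>u\<bar>"
      using supp
    proof eventually_elim
      case (elim x)
      then have "2 * pi * \<bar>u\<bar> * \<bar>x\<bar> \<le> 2 * pi * \<bar>u\<bar> * R" by (intro mult_left_mono) auto
      also have "\<dots> = 2 * pi * R * \<bar>u\<bar>" by simp
      finally show ?case using norm_expo_diff_le [of s u x] by linarith
    qed
  qed auto
  also have "\<dots> = 2 * pi * R * \<bar>u\<bar>" using prob_space by simp
  finally show ?thesis .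
qed

text \<open>Completing the square in \<open>c\<close>; the character has norm 1.\<close>

lemma nsq_minus_expo:
  assumes f: "f \<in> borel_measurable borel" "\<And>x. norm (f x) \<le> K"
  shows "nsq M (\<lambda>x. f x - c * expo t x)
    = nsq M f - (norm (L2_inner M f (expo t)))\<^sup>2 + (norm (c - L2_inner M f (expo t)))\<^sup>2"
proof -
  have [measurable]: "f \<in> borel_measurable borel" by fact
  have int1: "integrable M (\<lambda>x. f x * cnj (expo t x))"
    by (rule integrable_bounded [of _ K]) (use f in \<open>auto simp: norm_mult expo_minus [symmetric]\<close>)
  have int2: "integrable M (\<lambda>x. (norm (f x))\<^sup>2)"
    using square_integrable_bounded [OF f] by (simp add: square_integrable_def)
  define r where "r x = Re (cnj c * (f x * cnj (expo t x)))" for x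
  have r: "integrable M r" "(LINT x|M. r x) = Re (cnj c * L2_inner M f (expo t))"
    using int1 by (simp_all add: r_def [abs_def] L2_inner_def integral_Re [symmetric] del: times_complex.sel)
  have "(norm (f x - c * expo t x))\<^sup>2 = (norm (f x))\<^sup>2 - 2 * r x + (norm c)\<^sup>2" for x
  proof -
    have "(norm (f x - c * expo t x))\<^sup>2 = (norm (f x))\<^sup>2 + (norm (c * expo t x))\<^sup>2 - 2 * Re (f x * cnj (c * expo t x))"
      unfolding cmod_power2 by (simp add: power2_eq_square algebra_simps)
    then show ?thesis by (simp add: norm_mult mult_ac r_def)
  qed
  then have "nsq M (\<lambda>x. f x - c * expo t x) = (LINT x|M. (norm (f x))\<^sup>2 - 2 * r x + (norm c)\<^sup>2)"
    by (simp add: nsq_def)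
  also have "\<dots> = nsq M f - 2 * Re (cnj c * L2_inner M f (expo t)) + (norm c)\<^sup>2"
    using r int2 by (simp add: nsq_def del: times_complex.sel)
  also have "\<dots> = nsq M f - (norm (L2_inner M f (expo t)))\<^sup>2 + (norm (c - L2_inner M f (expo t)))\<^sup>2"
    unfolding cmod_power2 by (simp add: power2_eq_square algebra_simps)
  finally show ?thesis .
qed

text \<open>Removing one character does not change the coefficients at the orthogonal ones, so the
  frequencies can be split off one by one; the bound \<open>K\<close> varies in the induction
  because it grows with each removal. Arbitrary \<open>c\<close> covers both the projection itself
  and the comparison of any other approximation with it.\<close>

lemma orthogonal_expansion:
  assumes "finite F" "\<And>s t. s \<in> F \<Longrightarrow> t \<in> F \<Longrightarrow> s \<noteq> t \<Longrightarrow> ft (s - t) = 0"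
    and "f \<in> borel_measurable borel" "\<And>x. norm (f x) \<le> K"
  shows "nsq M (\<lambda>x. f x - (\<Sum>t\<in>F. c t * expo t x)) = nsq M f
    - (\<Sum>t\<in>F. (norm (L2_inner M f (expo t)))\<^sup>2) + (\<Sum>t\<in>F. (norm (c t - L2_inner M f (expo t)))\<^sup>2)"
  using assms
proof (induction F arbitrary: f K rule: finite_induct)
  case empty
  then show ?case by simp
next
  case (insert s F)
  define g where "g x = f x - c s * expo s x" for x
  have g: "g \<in> borel_measurable borel" "\<And>x. norm (g x) \<le> K + norm (c s)"
  proof -
    have [measurable]: "f \<in> borel_measurable borel" by fact
    show "g \<in> borel_measurable borel" unfolding g_def by measurable
    show "norm (g x) \<le> K + norm (c s)" for x
      using norm_triangle_ineq4 [of "f x" "c s * expo s x"] insert.prems(3) [of x]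
      by (simp add: g_def norm_mult)
  qed
  have int1: "integrable M (\<lambda>x. f x * cnj (expo t x))" for t
    by (rule integrable_bounded [of _ K])
       (use insert.prems in \<open>auto simp: norm_mult expo_minus [symmetric]\<close>)
  have "L2_inner M g (expo t) = L2_inner M f (expo t)" if "t \<in> F" for t
  proof -
    have "L2_inner M g (expo t) = (LINT x|M. f x * cnj (expo t x) - c s * (expo s x * cnj (expo t x)))"
      by (simp add: L2_inner_def g_def algebra_simps)
    also have "\<dots> = L2_inner M f (expo t) - c s * ft (s - t)"
      using int1 by (simp add: L2_inner_def ft_def expo_diff [symmetric])
    also have "ft (s - t) = 0" using insert.prems(1) insert.hyps that by auto
    finally show ?thesis by simp
  qed
  moreover have "nsq M (\<lambda>x. g x - (\<Sum>t\<in>F. c t * expo t x)) = nsq M g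
    - (\<Sum>t\<in>F. (norm (L2_inner M g (expo t)))\<^sup>2) + (\<Sum>t\<in>F. (norm (c t - L2_inner M g (expo t)))\<^sup>2)"
    using insert.prems(1) g by (intro insert.IH) auto
  moreover have "nsq M g = nsq M f - (norm (L2_inner M f (expo s)))\<^sup>2 + (norm (c s - L2_inner M f (expo s)))\<^sup>2"
    unfolding g_def using insert.prems by (intro nsq_minus_expo)
  moreover have "(\<lambda>x. f x - (\<Sum>t\<in>insert s F. c t * expo t x)) = (\<lambda>x. g x - (\<Sum>t\<in>F. c t * expo t x))"
    using insert.hyps by (auto simp: g_def algebra_simps)
  ultimately show ?case using insert.hyps by simp
qed

text \<open>A lower frame bound on trigonometric polynomials already gives completeness: subtracting the
  partial projection leaves a trigonometric polynomial, and each such step shrinks the squared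
  distance to the span by the factor \<open>1 - c\<close>.\<close>

lemma frame_imp_spectrum:
  assumes supp: "AE x in M. \<bar>x\<bar> \<le> R"
    and orth: "\<And>s t. s \<in> \<Lambda> \<Longrightarrow> t \<in> \<Lambda> \<Longrightarrow> s \<noteq> t \<Longrightarrow> ft (s - t) = 0"
    and c: "0 < c" "c \<le> 1"
    and frame: "\<And>f. f \<in> trig_span UNIV \<Longrightarrow> nsq M f > 0 \<Longrightarrow>
      \<exists>F. finite F \<and> F \<subseteq> \<Lambda> \<and> c * nsq M f \<le> (\<Sum>t\<in>F. (norm (L2_inner M f (expo t)))\<^sup>2)"
  shows "is_spectrum M \<Lambda>"
proof -
  have step: "\<exists>h\<in>trig_span \<Lambda>. nsq M (\<lambda>x. f x - h x) \<le> (1 - c) * nsq M f" if f: "f \<in> trig_span UNIV" for f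
  proof (cases "nsq M f > 0")
    case True
    then obtain F where F: "finite F" "F \<subseteq> \<Lambda>" "c * nsq M f \<le> (\<Sum>t\<in>F. (norm (L2_inner M f (expo t)))\<^sup>2)"
      using frame f by blast
    obtain K where K: "\<And>x. norm (f x) \<le> K" using trig_span_bounded [OF f] by blast
    have "nsq M (\<lambda>x. f x - (\<Sum>t\<in>F. L2_inner M f (expo t) * expo t x))
        = nsq M f - (\<Sum>t\<in>F. (norm (L2_inner M f (expo t)))\<^sup>2)"
      using orthogonal_expansion [OF F(1) _ trig_span_measurable [OF f] K, of "\<lambda>t. L2_inner M f (expo t)"] orth F(2)
      by (simp add: subset_iff)
    also have "\<dots> \<le> (1 - c) * nsq M f" using F(3) by (simp add: algebra_simps)
    finally show ?thesis
      using trig_span_sum [OF F(1,2), of "\<lambda>t. L2_inner M f (expo t)"] by (intro bexI)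
  next
    case False
    then have "nsq M f = 0" using nsq_nonneg [of M f] by simp
    then show ?thesis using trig_span_zero by (intro bexI [of _ "\<lambda>_. 0"]) auto
  qed
  have approx: "\<exists>h\<in>trig_span \<Lambda>. nsq M (\<lambda>x. f x - h x) \<le> (1 - c) ^ k * nsq M f"
    if f: "f \<in> trig_span UNIV" for f k
  proof (induction k)
    case 0
    show ?case using trig_span_zero by (intro bexI [of _ "\<lambda>_. 0"]) auto
  next
    case (Suc k)
    then obtain h where h: "h \<in> trig_span \<Lambda>" "nsq M (\<lambda>x. f x - h x) \<le> (1 - c) ^ k * nsq M f" by blast
    have "(\<lambda>x. f x - h x) \<in> trig_span UNIV"
      using trig_span_diff [OF f trig_span_mono [OF h(1)]] by simp
    from step [OF this] obtain h' where h': "h' \<in> trig_span \<Lambda>"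
      "nsq M (\<lambda>x. f x - h x - h' x) \<le> (1 - c) * nsq M (\<lambda>x. f x - h x)" by blast
    have "nsq M (\<lambda>x. f x - (h x + h' x)) \<le> (1 - c) * nsq M (\<lambda>x. f x - h x)"
      using h'(2) by (simp add: algebra_simps)
    also have "\<dots> \<le> (1 - c) * ((1 - c) ^ k * nsq M f)"
      using h(2) c by (intro mult_left_mono) auto
    finally show ?case using trig_span_add [OF h(1) h'(1)] by (auto simp: mult.assoc)
  qed
  have complete: "\<exists>F d. finite F \<and> F \<subseteq> \<Lambda> \<and> L2_norm M (\<lambda>x. f x - (\<Sum>t\<in>F. d t * expo t x)) < e"
    if f: "square_integrable M f" and e: "e > 0" for f e
  proof -
    \<comment> \<open>Two errors below a quarter of the target, each doubled by
      \<open>nsq_add_le\<close>, stay below the target.\<close>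
    have "e\<^sup>2 / 4 > 0" using e by simp
    then obtain p where p: "p \<in> trig_span UNIV" "nsq M (\<lambda>x. f x - p x) < e\<^sup>2 / 4"
      by (rule trig_closureD [OF trig_dense [OF supp f]])
    have "(\<lambda>k. (1 - c) ^ k * nsq M p) \<longlonglongrightarrow> 0 * nsq M p"
      using c by (intro tendsto_intros LIMSEQ_realpow_zero) auto
    then have "\<forall>\<^sub>F k in sequentially. (1 - c) ^ k * nsq M p < e\<^sup>2 / 4"
      using e by (intro order_tendstoD(2)) auto
    then obtain k where "(1 - c) ^ k * nsq M p < e\<^sup>2 / 4" by (auto simp: eventually_sequentially)
    with approx [OF p(1), of k] obtain h where h: "h \<in> trig_span \<Lambda>" "nsq M (\<lambda>x. p x - h x) < e\<^sup>2 / 4"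
      by fastforce
    have "nsq M (\<lambda>x. (f x - p x) + (p x - h x)) \<le> 2 * nsq M (\<lambda>x. f x - p x) + 2 * nsq M (\<lambda>x. p x - h x)"
      using f p h by (intro nsq_add_le square_integrable_diff) (auto intro: square_integrable_trig_span)
    then have "nsq M (\<lambda>x. f x - h x) < e\<^sup>2" using p h by simp
    then have "L2_norm M (\<lambda>x. f x - h x) < e" using e by (simp add: L2_norm_less_iff)
    then show ?thesis using h(1) unfolding trig_span_def by blast
  qed
  have "L2_norm M (expo t) = 1" for t
    using prob_space by (simp add: L2_norm_def)
  then show ?thesis
    unfolding is_spectrum_def orthogonal_basis_def
    using orth complete by (auto simp: L2_inner_expo intro: square_integrable_trig_span trig_span_expo)
qed

text \<open>Multiplication by \<open>expo u\<close> preserves moduli and carries the characters over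
  \<open>\<Lambda>\<close> to those over the translate, so approximating \<open>f\<close> over the
  translate amounts to approximating \<open>f\<close> times \<open>expo (- u)\<close> over
  \<open>\<Lambda>\<close>.\<close>

lemma spectrum_translate:
  assumes "is_spectrum M \<Lambda>"
  shows "is_spectrum M ((+) u ` \<Lambda>)"
proof -
  have o: "square_integrable M (expo t)" "L2_norm M (expo t) \<noteq> 0" for t
    using square_integrable_trig_span [OF trig_span_expo [of t UNIV]] by (auto simp: L2_norm_def)
  have "\<exists>F c. finite F \<and> F \<subseteq> (+) u ` \<Lambda> \<and> L2_norm M (\<lambda>x. f x - (\<Sum>t\<in>F. c t * expo t x)) < e"
    if f: "square_integrable M f" and e: "e > 0" for f e
  proof -
    define g where "g x = f x * expo (- u) x" for x
    have "square_integrable M g"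
      using f by (auto simp: square_integrable_def g_def [abs_def] norm_mult intro!: borel_measurable_times)
    then obtain F c where F: "finite F" "F \<subseteq> \<Lambda>" "L2_norm M (\<lambda>x. g x - (\<Sum>t\<in>F. c t * expo t x)) < e"
      using assms e unfolding is_spectrum_def orthogonal_basis_def by blast
    have "norm (f x - (\<Sum>t\<in>(+) u ` F. c (t - u) * expo t x)) = norm (g x - (\<Sum>t\<in>F. c t * expo t x))" for x
    proof -
      have "f x = expo u x * g x"
        using expo_add [of u "- u" x] by (simp add: g_def mult_ac)
      moreover have "(\<Sum>t\<in>(+) u ` F. c (t - u) * expo t x) = expo u x * (\<Sum>t\<in>F. c t * expo t x)"
        by (subst sum.reindex) (simp_all add: expo_add sum_distrib_left mult_ac)
      ultimately show ?thesis
        by (simp add: right_diff_distrib [symmetric] norm_mult)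
    qed
    then have "L2_norm M (\<lambda>x. f x - (\<Sum>t\<in>(+) u ` F. c (t - u) * expo t x)) < e"
      using F(3) by (simp add: L2_norm_def)
    then show ?thesis using F(1,2)
      by (intro exI [of _ "(+) u ` F"] exI [of _ "\<lambda>t. c (t - u)"]) auto
  qed
  then show ?thesis
    using assms unfolding is_spectrum_def orthogonal_basis_def
    by (auto simp: o L2_inner_expo)
qed

end

lemma norm_sum_squared:
  "complex_of_real ((norm (\<Sum>s\<in>F. g s))\<^sup>2) = (\<Sum>s\<in>F. \<Sum>t\<in>F. g s * cnj (g t))"
  by (simp only: complex_norm_square cnj_sum sum_product)

context real_distribution
begin

lemma L2_inner_trig_sum:
  assumes "finite F"
  shows "L2_inner M (\<lambda>x. \<Sum>t\<in>F. c t * expo t x) (expo l) = (\<Sum>t\<in>F. c t * ft (t - l))"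
proof -
  have "L2_inner M (\<lambda>x. \<Sum>t\<in>F. c t * expo t x) (expo l) = (LINT x|M. (\<Sum>t\<in>F. c t * expo (t - l) x))"
    by (simp add: L2_inner_def expo_diff sum_distrib_right mult.assoc)
  then show ?thesis using assms by (simp add: ft_def)
qed

text \<open>The Gram matrix of the characters has the entries \<open>ft (s - t)\<close>, so norms of
  trigonometric polynomials converge when the transforms do.\<close>

lemma nsq_trig_sum:
  assumes "finite F"
  shows "complex_of_real (nsq M (\<lambda>x. \<Sum>t\<in>F. c t * expo t x)) = (\<Sum>s\<in>F. \<Sum>t\<in>F. c s * cnj (c t) * ft (s - t))"
proof -
  have "complex_of_real (nsq M (\<lambda>x. \<Sum>t\<in>F. c t * expo t x))
      = (LINT x|M. complex_of_real ((norm (\<Sum>t\<in>F. c t * expo t x))\<^sup>2))"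
    unfolding nsq_def by (rule integral_complex_of_real [symmetric])
  also have "\<dots> = (LINT x|M. (\<Sum>s\<in>F. \<Sum>t\<in>F. c s * cnj (c t) * expo (s - t) x))"
    unfolding norm_sum_squared expo_diff by (simp add: mult_ac)
  also have "\<dots> = (\<Sum>s\<in>F. \<Sum>t\<in>F. c s * cnj (c t) * ft (s - t))"
    using assms by (simp add: ft_def)
  finally show ?thesis .
qed

lemma spectrum_approx:
  assumes "is_spectrum M \<Lambda>" "square_integrable M f" "e > 0"
  obtains F c where "finite F" "F \<subseteq> \<Lambda>" "L2_norm M (\<lambda>x. f x - (\<Sum>t\<in>F. c t * expo t x)) < e"
proof -
  have "\<exists>F c. finite F \<and> F \<subseteq> \<Lambda> \<and> L2_norm M (\<lambda>x. f x - (\<Sum>t\<in>F. c t * expo t x)) < e"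
    using assms by (simp add: is_spectrum_def orthogonal_basis_def)
  then show ?thesis using that by auto
qed

lemma spectrum_orthogonal:
  "is_spectrum M \<Lambda> \<Longrightarrow> s \<in> \<Lambda> \<Longrightarrow> t \<in> \<Lambda> \<Longrightarrow> s \<noteq> t \<Longrightarrow> ft (s - t) = 0"
  by (simp add: is_spectrum_def orthogonal_basis_def L2_inner_expo)

lemma spectrum_nonempty: "is_spectrum M \<Lambda> \<Longrightarrow> \<Lambda> \<noteq> {}"
proof
  assume sp: "is_spectrum M \<Lambda>" and "\<Lambda> = {}"
  have "square_integrable M (\<lambda>x. 1)" by (simp add: square_integrable_def)
  then obtain F c where F: "F \<subseteq> \<Lambda>" "L2_norm M (\<lambda>x. 1 - (\<Sum>t\<in>F. c t * expo t x)) < 1"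
    by (rule spectrum_approx [OF sp _ zero_less_one])
  then have "F = {}" using \<open>\<Lambda> = {}\<close> by simp
  then show False using F(2) by (simp add: L2_norm_def)
qed

text \<open>Frequencies of a spectrum are separated because the Fourier transform does not vanish near
  \<open>0\<close>, so small translations produce distinct spectra.\<close>

lemma spectrum_imp_infinitely_many:
  assumes sp: "is_spectrum M \<Lambda>"
  shows "infinite {\<Lambda>. is_spectrum M \<Lambda>}"
proof -
  obtain l where l: "l \<in> \<Lambda>" using spectrum_nonempty [OF sp] by blast
  have "\<forall>\<^sub>F u in at 0. ft u \<noteq> 0"
    using isCont_ft [of 0] by (intro tendsto_imp_eventually_ne [of ft 1]) (auto simp: isCont_def)
  then obtain \<delta> where \<delta>: "\<delta> > 0" "\<And>u. u \<noteq> 0 \<Longrightarrow> \<bar>u\<bar> < \<delta> \<Longrightarrow> ft u \<noteq> 0"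
    by (auto simp: eventually_at dist_real_def)
  have "inj_on (\<lambda>u. (+) u ` \<Lambda>) {0..<\<delta>}"
  proof (rule inj_onI, rule ccontr)
    fix u v assume uv: "u \<in> {0..<\<delta>}" "v \<in> {0..<\<delta>}" "(+) u ` \<Lambda> = (+) v ` \<Lambda>" "u \<noteq> v"
    then have "u + l \<in> (+) v ` \<Lambda>" using l by blast
    then have "l + (u - v) \<in> \<Lambda>" by (auto simp: algebra_simps)
    then have "ft (u - v) = 0"
      using spectrum_orthogonal [OF sp, of "l + (u - v)" l] l uv(4) by simp
    moreover have "\<bar>u - v\<bar> < \<delta>" using uv by auto
    ultimately show False using \<delta>(2) [of "u - v"] uv(4) by simp
  qed
  moreover have "infinite {0..<\<delta>}" using \<delta>(1) by (simp add: infinite_Ico)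
  ultimately have "infinite ((\<lambda>u. (+) u ` \<Lambda>) ` {0..<\<delta>})" by (simp add: finite_image_iff)
  moreover have "(\<lambda>u. (+) u ` \<Lambda>) ` {0..<\<delta>} \<subseteq> {\<Lambda>. is_spectrum M \<Lambda>}"
    using spectrum_translate [OF sp] by blast
  ultimately show ?thesis using finite_subset by blast
qed

end

section \<open>The spectrum of a self-similar measure\<close>

context hadamard
begin

text \<open>By \<open>H_eq\<close> the true coefficient \<open>D l\<close> differs from
  \<open>H (- l / a ^ n) * T n l\<close> only in that \<open>H\<close> is evaluated at a point
  displaced by \<open>t / a ^ n\<close>; the Lipschitz bound makes this error small in the sum over
  all \<open>l\<close>. The \<open>T n l\<close> satisfy an exact Parseval identity, and the lower
  bound on \<open>H\<close> transfers it to the \<open>D l\<close>.\<close>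

lemma spectrum_exists:
  assumes "real_distribution \<mu>" and supp: "AE x in \<mu>. \<bar>x\<bar> \<le> R"
    and step: "\<And>x. real_distribution.ft \<mu> x = m (x / a) * real_distribution.ft \<mu> (x / a)"
  shows "\<exists>\<Lambda>. is_spectrum \<mu> \<Lambda>"
proof -
  interpret \<mu>: real_distribution \<mu> by fact
  define H where "H = \<mu>.ft"
  interpret hadamard_transform A B L H
  proof
    show "H x = m (x / a) * H (x / a)" for x unfolding H_def by (rule step)
    show "isCont H x" for x unfolding H_def by (rule \<mu>.isCont_ft)
    show "H 0 = 1" unfolding H_def by (rule \<mu>.ft_0)
  qed
  obtain \<epsilon> N \<Lambda> where \<epsilon>: "\<epsilon> > 0" and N: "strict_mono N"
    and \<Lambda>: "\<And>j. \<Lambda> j \<subseteq> \<Lambda> (Suc j)" "\<And>j. tight (N j) (\<Lambda> j)"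
      "\<And>j l. l \<in> \<Lambda> j \<Longrightarrow> \<epsilon> \<le> norm (H (- l / a ^ N j))"
    using tight_sequence by metis
  \<comment> \<open>One factor 2 is lost in separating \<open>D\<close> from its error, the other in
    absorbing the limiting error; the minimum serves the requirement
    \<open>c \<le> 1\<close>.\<close>
  define c where "c = min 1 (\<epsilon>\<^sup>2 / 4)"
  have mono: "\<Lambda> i \<subseteq> \<Lambda> j" if "i \<le> j" for i j
    using \<Lambda>(1) that by (rule lift_Suc_mono_le)
  have "is_spectrum \<mu> (\<Union>j. \<Lambda> j)"
  proof (rule \<mu>.frame_imp_spectrum [OF supp, of _ c])
    fix s t assume "s \<in> (\<Union>j. \<Lambda> j)" "t \<in> (\<Union>j. \<Lambda> j)" "s \<noteq> t"
    then obtain i j where "s \<in> \<Lambda> i" "t \<in> \<Lambda> j" by blast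
    then have "s \<in> \<Lambda> (max i j)" "t \<in> \<Lambda> (max i j)"
      using mono [of i "max i j"] mono [of j "max i j"] by auto
    then have "M (N (max i j)) (s - t) = 0"
      using tight_orthogonal [OF \<Lambda>(2)] \<open>s \<noteq> t\<close> by blast
    then show "\<mu>.ft (s - t) = 0" using H_eq [of "s - t" "N (max i j)"] by (simp add: H_def)
  next
    show "0 < c" "c \<le> 1" using \<epsilon> by (auto simp: c_def)
  next
    fix f assume f: "f \<in> trig_span UNIV" and pos: "nsq \<mu> f > 0"
    obtain F d where F: "finite F" and fd: "f = (\<lambda>x. \<Sum>t\<in>F. d t * expo t x)"
      using f by (auto simp: trig_span_def)
    \<comment> \<open>The inner product of \<open>f\<close> with \<open>expo l\<close> for the
      \<open>n\<close>-th approximating measure; \<open>Q n\<close> below is the squared norm of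
      \<open>f\<close> for that measure.\<close>
    define T where "T n l = (\<Sum>t\<in>F. d t * M n (t - l))" for n l
    define D where "D l = L2_inner \<mu> f (expo l)" for l
    have D: "D l = (\<Sum>t\<in>F. d t * H (t - l))" for l
      unfolding D_def fd H_def by (rule \<mu>.L2_inner_trig_sum [OF F])
    define C where "C = 2 * pi * R"
    have lip: "norm (H (s + u) - H s) \<le> C * \<bar>u\<bar>" for s u
      unfolding H_def C_def by (rule \<mu>.ft_lipschitz [OF supp])
    \<comment> \<open>\<open>card F\<close> is the Cauchy-Schwarz factor. No dependence on the stage
      enters, although the sets \<open>\<Lambda> j\<close> grow.\<close>
    define K where "K = (\<Sum>t\<in>F. (norm (d t) * (C * \<bar>t\<bar>))\<^sup>2) * card F"
    define Q where "Q n = Re (\<Sum>s\<in>F. \<Sum>t\<in>F. d s * cnj (d t) * M n (s - t))" for n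
    have T_sum: "(\<Sum>l\<in>\<Lambda> j. (norm (T (N j) l))\<^sup>2) = Q (N j)" for j
    proof -
      have "complex_of_real (\<Sum>l\<in>\<Lambda> j. (norm (T (N j) l))\<^sup>2)
          = (\<Sum>l\<in>\<Lambda> j. \<Sum>s\<in>F. \<Sum>t\<in>F. d s * cnj (d t) * (M (N j) (s - l) * cnj (M (N j) (t - l))))"
        unfolding T_def of_real_sum norm_sum_squared by (simp add: mult_ac)
      also have "\<dots> = (\<Sum>s\<in>F. \<Sum>t\<in>F. d s * cnj (d t) * (\<Sum>l\<in>\<Lambda> j. M (N j) (s - l) * cnj (M (N j) (t - l))))"
        by (subst sum.swap, rule sum.cong [OF refl], subst sum.swap) (simp add: sum_distrib_left)
      also have "\<dots> = (\<Sum>s\<in>F. \<Sum>t\<in>F. d s * cnj (d t) * M (N j) (s - t))"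
        using \<Lambda>(2) [of j] by (simp add: tight_def)
      finally show ?thesis unfolding Q_def by (metis Re_complex_of_real)
    qed
    have M_sum: "(\<Sum>l\<in>\<Lambda> j. (norm (M (N j) (t - l)))\<^sup>2) = 1" for j t
    proof -
      have "complex_of_real (\<Sum>l\<in>\<Lambda> j. (norm (M (N j) (t - l)))\<^sup>2) = 1"
        using \<Lambda>(2) [of j] by (simp add: tight_def complex_norm_square del: of_real_power)
      then show ?thesis by (metis of_real_eq_1_iff)
    qed
    have err: "(\<Sum>l\<in>\<Lambda> j. (norm (H (- l / a ^ N j) * T (N j) l - D l))\<^sup>2) \<le> K / (a ^ N j)\<^sup>2" for j
    proof -
      let ?n = "N j"
      have 1: "norm (H (- l / a ^ ?n) * T ?n l - D l)
          \<le> (\<Sum>t\<in>F. norm (d t) * (C * \<bar>t\<bar>) / a ^ ?n * norm (M ?n (t - l)))" for l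
      proof -
        have eq: "H (- l / a ^ ?n) * T ?n l - D l
            = (\<Sum>t\<in>F. d t * M ?n (t - l) * (H (- l / a ^ ?n) - H (- l / a ^ ?n + t / a ^ ?n)))"
        proof -
          have "H (t - l) = M ?n (t - l) * H (- l / a ^ ?n + t / a ^ ?n)" for t
            using H_eq [of "t - l" ?n] by (simp add: diff_divide_distrib)
          then show ?thesis
            unfolding D T_def by (simp add: sum_distrib_left sum_subtractf [symmetric] algebra_simps)
        qed
        show ?thesis
          unfolding eq
        proof (rule sum_norm_le)
          fix t
          have "norm (H (- l / a ^ ?n) - H (- l / a ^ ?n + t / a ^ ?n)) \<le> C * \<bar>t\<bar> / a ^ ?n"
            using lip [of "- l / a ^ ?n" "t / a ^ ?n"] a by (simp add: norm_minus_commute abs_divide)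
          then have "norm (d t) * norm (M ?n (t - l)) * norm (H (- l / a ^ ?n) - H (- l / a ^ ?n + t / a ^ ?n))
              \<le> norm (d t) * norm (M ?n (t - l)) * (C * \<bar>t\<bar> / a ^ ?n)"
            by (intro mult_left_mono) auto
          then show "norm (d t * M ?n (t - l) * (H (- l / a ^ ?n) - H (- l / a ^ ?n + t / a ^ ?n)))
              \<le> norm (d t) * (C * \<bar>t\<bar>) / a ^ ?n * norm (M ?n (t - l))"
            by (simp add: norm_mult mult_ac)
        qed
      qed
      \<comment> \<open>Keeping the weights \<open>M ?n (t - l)\<close> is essential: after
        exchanging the sums, \<open>M_sum\<close> evaluates the sum over \<open>l\<close> to 1,
        whatever the size of \<open>\<Lambda> j\<close>.\<close>
      have "(\<Sum>l\<in>\<Lambda> j. (norm (H (- l / a ^ ?n) * T ?n l - D l))\<^sup>2)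
          \<le> (\<Sum>l\<in>\<Lambda> j. (\<Sum>t\<in>F. (norm (d t) * (C * \<bar>t\<bar>) / a ^ ?n * norm (M ?n (t - l)))\<^sup>2) * card F)"
        by (intro sum_mono order_trans [OF power_mono [OF 1] sum_squared_le_sum_of_squares]) (auto simp: F)
      also have "\<dots> = (\<Sum>t\<in>F. (norm (d t) * (C * \<bar>t\<bar>) / a ^ ?n)\<^sup>2 * (\<Sum>l\<in>\<Lambda> j. (norm (M ?n (t - l)))\<^sup>2)) * card F"
        unfolding sum_distrib_right [symmetric]
        by (subst sum.swap) (simp only: sum_distrib_left power_mult_distrib)
      also have "\<dots> = K / (a ^ ?n)\<^sup>2"
        unfolding M_sum K_def by (simp add: power_divide sum_divide_distrib [symmetric])
      finally show ?thesis .
    qed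
    have main: "\<epsilon>\<^sup>2 * Q (N j) \<le> 2 * (\<Sum>l\<in>\<Lambda> j. (norm (D l))\<^sup>2) + 2 * (K / (a ^ N j)\<^sup>2)" for j
    proof -
      have "\<epsilon>\<^sup>2 * Q (N j) = (\<Sum>l\<in>\<Lambda> j. (\<epsilon> * norm (T (N j) l))\<^sup>2)"
        unfolding T_sum [symmetric] by (simp add: sum_distrib_left power_mult_distrib)
      also have "\<dots> \<le> (\<Sum>l\<in>\<Lambda> j. 2 * (norm (D l))\<^sup>2 + 2 * (norm (H (- l / a ^ N j) * T (N j) l - D l))\<^sup>2)"
      proof (rule sum_mono)
        fix l assume "l \<in> \<Lambda> j"
        then have "\<epsilon> * norm (T (N j) l) \<le> norm (H (- l / a ^ N j) * T (N j) l)"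
          unfolding norm_mult using \<Lambda>(3) by (intro mult_right_mono) auto
        then have "(\<epsilon> * norm (T (N j) l))\<^sup>2 \<le> (norm (H (- l / a ^ N j) * T (N j) l))\<^sup>2"
          using \<epsilon> by (intro power_mono) auto
        also have "\<dots> \<le> 2 * (norm (D l))\<^sup>2 + 2 * (norm (H (- l / a ^ N j) * T (N j) l - D l))\<^sup>2"
          using norm_add_squared_le [of "D l" "H (- l / a ^ N j) * T (N j) l - D l"] by simp
        finally show "(\<epsilon> * norm (T (N j) l))\<^sup>2 \<le> \<dots>" .
      qed
      also have "\<dots> \<le> 2 * (\<Sum>l\<in>\<Lambda> j. (norm (D l))\<^sup>2) + 2 * (K / (a ^ N j)\<^sup>2)"
        using err [of j] by (simp add: sum.distrib sum_distrib_left [symmetric])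
      finally show ?thesis .
    qed
    have "Q \<longlonglongrightarrow> Re (\<Sum>s\<in>F. \<Sum>t\<in>F. d s * cnj (d t) * H (s - t))"
      unfolding Q_def by (intro tendsto_intros M_tendsto)
    also have "Re (\<Sum>s\<in>F. \<Sum>t\<in>F. d s * cnj (d t) * H (s - t)) = nsq \<mu> f"
      unfolding fd H_def \<mu>.nsq_trig_sum [OF F, symmetric] by simp
    finally have "Q \<longlonglongrightarrow> nsq \<mu> f" .
    moreover have "(\<lambda>n. K / (a ^ n)\<^sup>2) \<longlonglongrightarrow> 0" using a by real_asymp
    ultimately have "(\<lambda>n. \<epsilon>\<^sup>2 * Q n - 2 * (K / (a ^ n)\<^sup>2)) \<longlonglongrightarrow> \<epsilon>\<^sup>2 * nsq \<mu> f - 2 * 0"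
      by (intro tendsto_intros)
    from LIMSEQ_subseq_LIMSEQ [OF this N]
    have "(\<lambda>j. \<epsilon>\<^sup>2 * Q (N j) - 2 * (K / (a ^ N j)\<^sup>2)) \<longlonglongrightarrow> \<epsilon>\<^sup>2 * nsq \<mu> f"
      by (simp add: o_def)
    \<comment> \<open>Positivity of \<open>nsq \<mu> f\<close> leaves strict room below the limit,
      so a single finite stage \<open>\<Lambda> j\<close> already meets the frame bound.\<close>
    moreover have "\<epsilon>\<^sup>2 * nsq \<mu> f / 2 < \<epsilon>\<^sup>2 * nsq \<mu> f" using \<epsilon> pos by simp
    ultimately have "\<forall>\<^sub>F j in sequentially. \<epsilon>\<^sup>2 * nsq \<mu> f / 2 < \<epsilon>\<^sup>2 * Q (N j) - 2 * (K / (a ^ N j)\<^sup>2)"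
      by (rule order_tendstoD)
    then obtain j where "\<epsilon>\<^sup>2 * nsq \<mu> f / 2 < \<epsilon>\<^sup>2 * Q (N j) - 2 * (K / (a ^ N j)\<^sup>2)"
      by (auto simp: eventually_sequentially)
    then have "\<epsilon>\<^sup>2 / 4 * nsq \<mu> f \<le> (\<Sum>l\<in>\<Lambda> j. (norm (D l))\<^sup>2)"
      using main [of j] by simp
    moreover have "c * nsq \<mu> f \<le> \<epsilon>\<^sup>2 / 4 * nsq \<mu> f"
      using pos by (intro mult_right_mono) (auto simp: c_def)
    ultimately have "c * nsq \<mu> f \<le> (\<Sum>l\<in>\<Lambda> j. (norm (L2_inner \<mu> f (expo l)))\<^sup>2)"
      unfolding D_def by linarith
    then show "\<exists>F. finite F \<and> F \<subseteq> (\<Union>j. \<Lambda> j) \<and> c * nsq \<mu> f \<le> (\<Sum>t\<in>F. (norm (L2_inner \<mu> f (expo t)))\<^sup>2)"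
      using \<Lambda>(2) [of j] by (intro exI [of _ "\<Lambda> j"]) (auto simp: tight_def)
  qed
  then show ?thesis by blast
qed

end

section \<open>Existence and uniqueness of the invariant measure\<close>

definition is_invariant :: "int \<Rightarrow> int set \<Rightarrow> real measure \<Rightarrow> bool" where
  "is_invariant A B \<mu> \<longleftrightarrow> prob_space \<mu> \<and> sets \<mu> = sets borel \<and>
     (\<forall>f\<in>Cc. (LINT x|\<mu>. f x) = 1 / of_nat (card B) * (\<Sum>b\<in>B. LINT x|\<mu>. (f \<circ> ifs_map A b) x))"

lemma is_invariant_real_distribution: "is_invariant A B \<mu> \<Longrightarrow> real_distribution \<mu>"
  by (simp add: is_invariant_def real_distribution_def real_distribution_axioms_def)

lemma borel_measurable_ifs_map [measurable]: "ifs_map A b \<in> borel_measurable borel"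
  unfolding ifs_map_def by measurable

lemma Cc_bounded:
  assumes "f \<in> Cc"
  shows "\<exists>K. \<forall>x. norm (f x) \<le> K"
proof -
  let ?S = "closure {x. f x \<noteq> 0}"
  have "compact (f ` ?S)"
    using assms by (intro compact_continuous_image) (auto simp: Cc_def intro: continuous_on_subset)
  then have "bounded (f ` ?S)" by (rule compact_imp_bounded)
  then obtain K where K: "\<forall>y\<in>f ` ?S. norm y \<le> K"
    by (auto simp only: bounded_iff)
  have "norm (f x) \<le> max K 0" for x
  proof (cases "f x = 0")
    case False
    then have "x \<in> ?S" by (intro subsetD [OF closure_subset]) simp
    then have "norm (f x) \<le> K" by (rule bspec [OF K imageI])
    then show ?thesis by simp
  qed simp
  then show ?thesis by blast
qed

lemma Cc_measurable: "f \<in> Cc \<Longrightarrow> f \<in> borel_measurable borel"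
  by (auto simp: Cc_def intro: borel_measurable_continuous_onI)

text \<open>Characters are not compactly supported, so invariance is applied to truncated characters
  and passed to the limit by dominated convergence.\<close>

lemma is_invariant_ft:
  assumes inv: "is_invariant A B \<mu>" and A: "A \<noteq> 0"
  shows "real_distribution.ft \<mu> t = mask B (t / of_int A) * real_distribution.ft \<mu> (t / of_int A)"
proof -
  interpret real_distribution \<mu> by (rule is_invariant_real_distribution [OF inv])
  \<comment> \<open>A continuous cutoff that vanishes for \<open>\<bar>x\<bar> \<ge> n\<close> and
    equals 1 for \<open>\<bar>x\<bar> \<le> n - 1\<close>.\<close>
  define \<phi> where "\<phi> n x = max 0 (min 1 (real n - \<bar>x\<bar>))" for n :: nat and x :: real
  define f where "f n x = of_real (\<phi> n x) * expo t x" for n x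
  have cont: "continuous_on UNIV (f n)" for n
    unfolding f_def \<phi>_def by (intro continuous_intros)
  have [measurable]: "f n \<in> borel_measurable borel" for n
    by (rule borel_measurable_continuous_onI [OF cont])
  have f_Cc: "f n \<in> Cc" for n
  proof -
    have "bounded {x. f n x \<noteq> 0}"
      by (rule bounded_subset [of "cball 0 (real n)"]) (auto simp: f_def \<phi>_def)
    then show ?thesis using cont by (simp add: Cc_def)
  qed
  \<comment> \<open>The inner map \<open>g\<close> lets one limit serve both sides of the invariance
    equation: the identity on the left, \<open>ifs_map A b\<close> on the right.\<close>
  have lim: "(\<lambda>n. LINT x|\<mu>. f n (g x)) \<longlonglongrightarrow> (LINT x|\<mu>. expo t (g x))"
    if [measurable]: "g \<in> borel_measurable borel" for g
  proof (rule integral_dominated_convergence [where w = "\<lambda>_. 1"])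
    show "AE x in \<mu>. (\<lambda>n. f n (g x)) \<longlonglongrightarrow> expo t (g x)"
    proof (rule AE_I2)
      fix x
      obtain N :: nat where N: "\<bar>g x\<bar> + 1 < real N" using reals_Archimedean2 by blast
      have "f n (g x) = expo t (g x)" if "n \<ge> N" for n
      proof -
        have "real N \<le> real n" using that by simp
        then have "\<phi> n (g x) = 1" using N unfolding \<phi>_def by linarith
        then show ?thesis by (simp add: f_def)
      qed
      then have "\<forall>\<^sub>F n in sequentially. f n (g x) = expo t (g x)"
        unfolding eventually_sequentially by blast
      then show "(\<lambda>n. f n (g x)) \<longlonglongrightarrow> expo t (g x)" by (rule tendsto_eventually)
    qed
    show "AE x in \<mu>. norm (f n (g x)) \<le> 1" for n
      by (rule AE_I2) (simp add: f_def \<phi>_def norm_mult)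
  qed auto
  have "(\<lambda>n. LINT x|\<mu>. f n x) \<longlonglongrightarrow> ft t"
    using lim [of "\<lambda>x. x"] by (simp add: ft_def)
  moreover have "(\<lambda>n. 1 / of_nat (card B) * (\<Sum>b\<in>B. LINT x|\<mu>. (f n \<circ> ifs_map A b) x))
      \<longlonglongrightarrow> 1 / of_nat (card B) * (\<Sum>b\<in>B. LINT x|\<mu>. expo t (ifs_map A b x))"
    unfolding o_def by (intro tendsto_intros lim) measurable
  moreover have "(LINT x|\<mu>. f n x) = 1 / of_nat (card B) * (\<Sum>b\<in>B. LINT x|\<mu>. (f n \<circ> ifs_map A b) x)" for n
    using inv f_Cc unfolding is_invariant_def by blast
  ultimately have "ft t = 1 / of_nat (card B) * (\<Sum>b\<in>B. LINT x|\<mu>. expo t (ifs_map A b x))"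
    by (metis (no_types, lifting) LIMSEQ_unique ext)
  moreover have "(LINT x|\<mu>. expo t (ifs_map A b x)) = expo (t / of_int A) (of_int b) * ft (t / of_int A)" for b
  proof -
    have "expo t (ifs_map A b x) = expo (t / of_int A) (of_int b) * expo (t / of_int A) x" for x
      by (simp add: expo_def ifs_map_def exp_add [symmetric] field_simps add_divide_distrib)
    then show ?thesis by (simp add: ft_def)
  qed
  ultimately show ?thesis by (simp add: mask_def sum_distrib_right)
qed

lemma is_invariant_ft_iter:
  assumes inv: "is_invariant A B \<mu>" and A: "A \<noteq> 0"
  shows "real_distribution.ft \<mu> t = (\<Prod>k<n. mask B (t / of_int A ^ Suc k)) * real_distribution.ft \<mu> (t / of_int A ^ n)"
proof (induction n)
  case (Suc n)
  show ?case
    using Suc is_invariant_ft [OF assms, of "t / of_int A ^ n"] by (simp add: mult_ac)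
qed simp

text \<open>Both transforms equal the same mask product times a factor tending to 1, so they
  coincide, and the transform determines the measure.\<close>

lemma is_invariant_unique:
  assumes A: "A \<ge> 2" and \<mu>: "is_invariant A B \<mu>" and \<nu>: "is_invariant A B \<nu>"
  shows "\<mu> = \<nu>"
proof -
  interpret \<mu>: real_distribution \<mu> by (rule is_invariant_real_distribution [OF \<mu>])
  interpret \<nu>: real_distribution \<nu> by (rule is_invariant_real_distribution [OF \<nu>])
  have A0: "A \<noteq> 0" and A2: "(of_int A :: real) \<ge> 2" using A by auto
  have lim: "(\<lambda>n. t / of_int A ^ n) \<longlonglongrightarrow> (0 :: real)" for t using A2 by real_asymp
  have eq: "\<mu>.ft t = \<nu>.ft t" for t
  proof -
    \<comment> \<open>Cross-multiplication avoids dividing by the mask product, which may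
      vanish.\<close>
    have "\<mu>.ft t * \<nu>.ft (t / of_int A ^ n) = \<nu>.ft t * \<mu>.ft (t / of_int A ^ n)" for n
      using is_invariant_ft_iter [OF \<mu> A0, of t n] is_invariant_ft_iter [OF \<nu> A0, of t n] by simp
    moreover have "(\<lambda>n. \<mu>.ft t * \<nu>.ft (t / of_int A ^ n)) \<longlonglongrightarrow> \<mu>.ft t * \<nu>.ft 0"
      by (intro tendsto_intros isCont_tendsto_compose [OF \<nu>.isCont_ft] lim)
    moreover have "(\<lambda>n. \<nu>.ft t * \<mu>.ft (t / of_int A ^ n)) \<longlonglongrightarrow> \<nu>.ft t * \<mu>.ft 0"
      by (intro tendsto_intros isCont_tendsto_compose [OF \<mu>.isCont_ft] lim)
    ultimately show ?thesis using LIMSEQ_unique by simp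
  qed
  have "char \<mu> = char \<nu>"
  proof
    fix t
    show "char \<mu> t = char \<nu> t"
      using eq [of "t / (2 * pi)"] by (simp add: \<mu>.ft_eq_char \<nu>.ft_eq_char)
  qed
  then show ?thesis
    by (rule Levy_uniqueness [OF \<mu>.real_distribution_axioms \<nu>.real_distribution_axioms])
qed

text \<open>The invariant measure is the distribution of \<open>\<Sum>k. \<omega> k / A ^ Suc k\<close> for independent digits
  \<open>\<omega> k\<close> uniformly distributed on \<open>B\<close>: splitting off the first digit gives the invariance.\<close>

lemma is_invariant_exists:
  assumes A: "A \<ge> 2" and B: "finite B" "B \<noteq> {}"
  shows "\<exists>\<mu> R. is_invariant A B \<mu> \<and> (AE x in \<mu>. \<bar>x\<bar> \<le> R)"
proof -
  let ?a = "real_of_int A"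
  have a2: "?a \<ge> 2" using A by simp
  define D where "D = uniform_count_measure B"
  have D: "prob_space D" unfolding D_def using B by (rule prob_space_uniform_count_measure)
  interpret sequence_space D
    using D prob_space_imp_sigma_finite
    by (simp add: sequence_space_def product_prob_space_def product_sigma_finite_def product_prob_space_axioms_def)
  have D_meas [measurable]: "real_of_int \<in> borel_measurable D"
    by (simp add: D_def measurable_def sets_uniform_count_measure space_uniform_count_measure)
  have int_D: "(LINT b|D. h b) = (\<Sum>b\<in>B. (1 / real (card B)) *\<^sub>R h b)" for h :: "int \<Rightarrow> complex"
    unfolding D_def uniform_count_measure_def using B(1)
    by (intro lebesgue_integral_point_measure_finite) simp_all
  define X where "X \<omega> = (\<Sum>k. real_of_int (\<omega> k) / ?a ^ Suc k)" for \<omega> :: "nat \<Rightarrow> int"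
  have X [measurable]: "X \<in> borel_measurable S"
    unfolding X_def by measurable
  define K where "K = Max ((\<lambda>b. \<bar>real_of_int b\<bar>) ` B)"
  \<comment> \<open>A geometric majorant common to all digit sequences: it gives both convergence of
    the series and the support radius \<open>R\<close>.\<close>
  have bound: "norm (real_of_int (\<omega> k) / ?a ^ Suc k) \<le> K * (1/2) ^ Suc k" if "\<omega> \<in> space S" for \<omega> k
  proof -
    have "\<omega> k \<in> B" using that by (auto simp: space_PiM D_def space_uniform_count_measure)
    then have 1: "\<bar>real_of_int (\<omega> k)\<bar> \<le> K" unfolding K_def using B by (intro Max_ge) auto
    have "2 ^ Suc k \<le> ?a ^ Suc k" using a2 by (intro power_mono) auto
    then have "\<bar>real_of_int (\<omega> k)\<bar> / ?a ^ Suc k \<le> K / 2 ^ Suc k"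
      using 1 a2 by (intro frac_le) auto
    then show ?thesis using a2 by (simp add: abs_divide power_one_over power_abs)
  qed
  have sm: "summable (\<lambda>k. K * (1/2) ^ Suc k)"
    by (intro summable_mult) (simp add: summable_Suc_iff)
  have summable: "summable (\<lambda>k. real_of_int (\<omega> k) / ?a ^ Suc k)" if "\<omega> \<in> space S" for \<omega>
    by (rule summable_comparison_test' [OF sm]) (rule bound [OF that])
  define R where "R = (\<Sum>k. K * (1/2) ^ Suc k)"
  have X_bound: "\<bar>X \<omega>\<bar> \<le> R" if "\<omega> \<in> space S" for \<omega>
    using norm_suminf_le [OF bound [OF that] sm] by (simp add: X_def R_def)
  have X_shift: "X (case_nat b \<omega>) = ifs_map A b (X \<omega>)" if "\<omega> \<in> space S" "b \<in> B" for \<omega> b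
  proof -
    have "case_nat b \<omega> \<in> space S"
      using that by (auto simp: space_PiM D_def space_uniform_count_measure PiE_def Pi_iff split: nat.split)
    from suminf_split_head [OF summable [OF this]]
    have "X (case_nat b \<omega>) = (\<Sum>k. real_of_int (\<omega> k) / ?a ^ Suc (Suc k)) + real_of_int b / ?a"
      by (simp add: X_def)
    also have "(\<Sum>k. real_of_int (\<omega> k) / ?a ^ Suc (Suc k)) = (\<Sum>k. (1 / ?a) * (real_of_int (\<omega> k) / ?a ^ Suc k))"
      by simp
    also have "\<dots> = (1 / ?a) * X \<omega>"
      unfolding X_def by (rule suminf_mult [OF summable [OF that(1)]])
    finally show ?thesis by (simp add: ifs_map_def divide_inverse algebra_simps)
  qed
  define \<mu> where "\<mu> = distr S borel X"
  interpret \<mu>: prob_space \<mu> unfolding \<mu>_def by (rule P.prob_space_distr [OF X])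
  have sets: "sets \<mu> = sets borel" by (simp add: \<mu>_def)
  have supp: "AE x in \<mu>. \<bar>x\<bar> \<le> R"
    unfolding \<mu>_def by (subst AE_distr_iff) (auto intro!: AE_I2 X_bound)
  interpret pair_sigma_finite D S
    by (intro pair_sigma_finite.intro prob_space_imp_sigma_finite D P.prob_space_axioms)
  interpret DS: prob_space "D \<Otimes>\<^sub>M S"
    by (intro prob_space_pair D P.prob_space_axioms)
  have inv: "(LINT x|\<mu>. f x) = 1 / of_nat (card B) * (\<Sum>b\<in>B. LINT x|\<mu>. (f \<circ> ifs_map A b) x)"
    if f: "f \<in> Cc" for f
  proof -
    obtain C where C: "\<And>x. norm (f x) \<le> C" using Cc_bounded [OF f] by blast
    note [measurable] = Cc_measurable [OF f]
    have shift_m [measurable]: "(\<lambda>(s, \<omega>). case_nat s \<omega>) \<in> measurable (D \<Otimes>\<^sub>M S) S"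
      by measurable
    have int: "integrable (D \<Otimes>\<^sub>M S) (\<lambda>p. f (X (case p of (s, \<omega>) \<Rightarrow> case_nat s \<omega>)))"
      by (rule DS.integrable_const_bound [of _ C]) (use C in auto)
    have "(LINT x|\<mu>. f x) = (LINT \<omega>|S. f (X \<omega>))"
      unfolding \<mu>_def by (rule integral_distr) measurable
    \<comment> \<open>Prepending an independent digit preserves the law of the sequence; on
      \<open>X\<close> it acts as \<open>ifs_map A b\<close>.\<close>
    also have "\<dots> = (LINT \<omega>|(distr (D \<Otimes>\<^sub>M S) S (\<lambda>(s, \<omega>). case_nat s \<omega>)). f (X \<omega>))"
      by (simp add: PiM_iter)
    also have "\<dots> = (LINT p|(D \<Otimes>\<^sub>M S). f (X (case p of (s, \<omega>) \<Rightarrow> case_nat s \<omega>)))"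
      by (rule integral_distr) measurable
    also have "\<dots> = (LINT b|D. LINT \<omega>|S. f (X (case_nat b \<omega>)))"
      using integral_fst' [OF int] by simp
    also have "\<dots> = (\<Sum>b\<in>B. (1 / real (card B)) *\<^sub>R (LINT \<omega>|S. f (X (case_nat b \<omega>))))"
      by (rule int_D)
    also have "\<dots> = (\<Sum>b\<in>B. 1 / of_nat (card B) * (LINT x|\<mu>. (f \<circ> ifs_map A b) x))"
    proof (rule sum.cong [OF refl])
      fix b assume "b \<in> B"
      have "(LINT \<omega>|S. f (X (case_nat b \<omega>))) = (LINT \<omega>|S. f (ifs_map A b (X \<omega>)))"
        by (rule Bochner_Integration.integral_cong) (simp_all add: X_shift \<open>b \<in> B\<close>)
      also have "\<dots> = (LINT x|\<mu>. f (ifs_map A b x))"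
        unfolding \<mu>_def by (rule integral_distr [symmetric]) measurable
      finally show "(1 / real (card B)) *\<^sub>R (LINT \<omega>|S. f (X (case_nat b \<omega>)))
          = 1 / of_nat (card B) * (LINT x|\<mu>. (f \<circ> ifs_map A b) x)"
        by (simp add: scaleR_conv_of_real o_def)
    qed
    finally show ?thesis by (simp add: sum_distrib_left)
  qed
  have "is_invariant A B \<mu>"
    using \<mu>.prob_space_axioms sets inv by (simp add: is_invariant_def)
  then show ?thesis using supp by blast
qed

text \<open>Uniqueness identifies the definite description with the constructed measure, from which
  the bounded support is read off.\<close>

lemma invariant_measure:
  assumes "A \<ge> 2" "finite B" "B \<noteq> {}"
  shows "is_invariant A B (invariant_measure A B)" "\<exists>R. AE x in invariant_measure A B. \<bar>x\<bar> \<le> R"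
proof -
  obtain \<mu> R where \<mu>: "is_invariant A B \<mu>" "AE x in \<mu>. \<bar>x\<bar> \<le> R"
    using is_invariant_exists [OF assms] by blast
  have "invariant_measure A B = \<mu>"
    unfolding invariant_measure_def is_invariant_def [symmetric]
    by (rule the_equality) (use \<mu>(1) is_invariant_unique [OF assms(1)] in auto)
  then show "is_invariant A B (invariant_measure A B)" "\<exists>R. AE x in invariant_measure A B. \<bar>x\<bar> \<le> R"
    using \<mu> by auto
qed

section \<open>Spectra of finite sets\<close>

lemma real_distribution_delta_measure:
  assumes "finite B" "B \<noteq> {}"
  shows "real_distribution (delta_measure B)"
proof -
  interpret prob_space "uniform_count_measure B"
    using assms by (rule prob_space_uniform_count_measure)
  have "prob_space (delta_measure B)"
    unfolding delta_measure_def
    by (rule prob_space_distr)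
       (simp add: measurable_def sets_uniform_count_measure space_uniform_count_measure)
  then show ?thesis
    by (simp add: real_distribution_def real_distribution_axioms_def delta_measure_def)
qed

lemma integral_delta_measure:
  fixes f :: "real \<Rightarrow> 'b::{banach, second_countable_topology}"
  assumes "finite B" "f \<in> borel_measurable borel"
  shows "(LINT x|delta_measure B. f x) = (1 / real (card B)) *\<^sub>R (\<Sum>b\<in>B. f b)"
proof -
  have "(LINT x|delta_measure B. f x) = (LINT x|uniform_count_measure B. f x)"
    unfolding delta_measure_def using assms(2)
    by (intro integral_distr)
       (simp_all add: measurable_def sets_uniform_count_measure space_uniform_count_measure)
  also have "\<dots> = (1 / real (card B)) *\<^sub>R (\<Sum>b\<in>B. f b)"
    unfolding uniform_count_measure_def using assms(1)
    by (subst lebesgue_integral_point_measure_finite) (simp_all add: scaleR_sum_right)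
  finally show ?thesis .
qed

text \<open>Every character, restricted to \<open>B\<close>, equals its orthogonal expansion over
  \<open>L / A\<close>; pairing this with a second character gives the two-variable
  identity.\<close>

lemma spectrum_of_set_imp_hadamard:
  assumes A: "A \<ge> 2" and B: "finite B" "0 \<in> B" and L: "0 \<in> L"
    and sp: "is_spectrum_of_set (real_of_int ` B) ((\<lambda>l. inverse (real_of_int A) * real_of_int l) ` L)"
  shows "hadamard A B L"
proof -
  let ?a = "real_of_int A"
  have a0: "?a \<noteq> 0" using A by simp
  define \<delta> where "\<delta> = delta_measure (real_of_int ` B)"
  define \<Lambda> where "\<Lambda> = (\<lambda>l. inverse ?a * real_of_int l) ` L"
  interpret real_distribution \<delta>
    unfolding \<delta>_def using B by (intro real_distribution_delta_measure) auto
  have N: "card B > 0" using B by (auto simp: card_gt_0_iff)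
  have integral: "(LINT x|\<delta>. f x) = (1 / real (card B)) *\<^sub>R (\<Sum>b\<in>B. f (of_int b))"
    if "f \<in> borel_measurable borel" for f :: "real \<Rightarrow> 'b::{banach, second_countable_topology}"
    unfolding \<delta>_def using B that
    by (subst integral_delta_measure) (auto simp: card_image inj_on_def sum.reindex)
  have ft: "ft t = mask B t" for t
    unfolding ft_def mask_def by (subst integral) (simp_all add: scaleR_conv_of_real)
  have sp': "is_spectrum \<delta> \<Lambda>" using sp by (simp add: is_spectrum_of_set_def \<delta>_def \<Lambda>_def)
  have orth: "ft (s - t) = 0" if "s \<in> \<Lambda>" "t \<in> \<Lambda>" "s \<noteq> t" for s t
    using spectrum_orthogonal [OF sp'] that by blast
  \<comment> \<open>Finiteness of \<open>L\<close> is derived from orthogonality: congruent digits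
    would give frequencies differing by an integer, where the mask is 1.\<close>
  have "inj_on (\<lambda>l. l mod A) L"
  proof (rule inj_onI, rule ccontr)
    fix l l' assume l: "l \<in> L" "l' \<in> L" "l mod A = l' mod A" "l \<noteq> l'"
    then obtain k where "l - l' = A * k" by (metis mod_eq_dvd_iff dvdE)
    then have "real_of_int l - real_of_int l' = ?a * of_int k" by (metis of_int_diff of_int_mult)
    then have "inverse ?a * of_int l - inverse ?a * of_int l' = of_int k"
      using a0 by (simp add: right_diff_distrib [symmetric])
    moreover have "ft (inverse ?a * of_int l - inverse ?a * of_int l') = 0"
      using l a0 by (intro orth) (auto simp: \<Lambda>_def)
    moreover have "mask B (of_int k) = 1" using N by (simp add: mask_def expo_int)
    ultimately show False by (simp add: ft)
  qed
  moreover have "(\<lambda>l. l mod A) ` L \<subseteq> {0..<A}" using A by auto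
  ultimately have fin_L: "finite L" by (meson finite_atLeastLessThan_int inj_on_finite)
  then have fin: "finite \<Lambda>" by (simp add: \<Lambda>_def)
  have expand: "expo x (of_int b) = (\<Sum>s\<in>\<Lambda>. mask B (x - s) * expo s (of_int b))" if b: "b \<in> B" for x b
  proof -
    \<comment> \<open>The remainder after projection onto all of \<open>\<Lambda>\<close>; the
      coefficients are the inner products with \<open>expo x\<close>.\<close>
    define g where "g y = expo x y - (\<Sum>s\<in>\<Lambda>. mask B (x - s) * expo s y)" for y
    have g_meas [measurable]: "g \<in> borel_measurable borel" unfolding g_def by measurable
    have nsq_1: "nsq \<delta> (expo x) = 1" by (simp add: nsq_def)
    have inner: "L2_inner \<delta> (expo x) (expo s) = mask B (x - s)" for s
      by (simp add: L2_inner_expo ft)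
    have expansion: "nsq \<delta> (\<lambda>y. expo x y - (\<Sum>s\<in>F. c s * expo s y))
        = 1 - (\<Sum>s\<in>F. (norm (mask B (x - s)))\<^sup>2) + (\<Sum>s\<in>F. (norm (c s - mask B (x - s)))\<^sup>2)"
      if F: "F \<subseteq> \<Lambda>" for F c
      unfolding nsq_1 [symmetric] inner [symmetric]
      by (rule orthogonal_expansion [where K = 1]) (use F fin finite_subset orth in \<open>auto simp: subset_iff\<close>)
    have "nsq \<delta> g = 1 - (\<Sum>s\<in>\<Lambda>. (norm (mask B (x - s)))\<^sup>2)"
      unfolding g_def by (subst expansion) simp_all
    also have "\<dots> \<le> 0"
    \<comment> \<open>Density only provides approximations over some \<open>F\<close> with unknown
      coefficients; by \<open>expansion\<close> none of them is closer than the projection onto all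
      of \<open>\<Lambda>\<close>.\<close>
    proof (rule field_le_epsilon)
      fix e :: real assume e: "e > 0"
      have "square_integrable \<delta> (expo x)" by (rule square_integrable_bounded [of _ 1]) auto
      moreover have "sqrt e > 0" using e by simp
      ultimately obtain F c where F: "F \<subseteq> \<Lambda>" "L2_norm \<delta> (\<lambda>y. expo x y - (\<Sum>s\<in>F. c s * expo s y)) < sqrt e"
        by (rule spectrum_approx [OF sp'])
      then have "1 - (\<Sum>s\<in>F. (norm (mask B (x - s)))\<^sup>2) + (\<Sum>s\<in>F. (norm (c s - mask B (x - s)))\<^sup>2) < e"
        using e by (simp add: L2_norm_less_iff expansion)
      moreover have "(\<Sum>s\<in>F. (norm (mask B (x - s)))\<^sup>2) \<le> (\<Sum>s\<in>\<Lambda>. (norm (mask B (x - s)))\<^sup>2)"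
        by (intro sum_mono2 fin F) auto
      moreover have "0 \<le> (\<Sum>s\<in>F. (norm (c s - mask B (x - s)))\<^sup>2)" by (intro sum_nonneg) auto
      ultimately show "1 - (\<Sum>s\<in>\<Lambda>. (norm (mask B (x - s)))\<^sup>2) \<le> 0 + e" by linarith
    qed
    finally have "nsq \<delta> g = 0" using nsq_nonneg [of \<delta> g] by simp
    \<comment> \<open>Every point of \<open>B\<close> has positive mass, so vanishing in norm
      becomes vanishing at each point.\<close>
    then have "(\<Sum>b\<in>B. (norm (g (of_int b)))\<^sup>2) = 0"
      using N unfolding nsq_def by (subst (asm) integral) simp_all
    then have "(norm (g (of_int b)))\<^sup>2 = 0"
      using B b by (subst (asm) sum_nonneg_eq_0_iff) auto
    then show ?thesis by (simp add: g_def)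
  qed
  have main: "(\<Sum>s\<in>\<Lambda>. mask B (x - s) * cnj (mask B (y - s))) = mask B (x - y)" for x y
  proof -
    have cnj: "cnj (mask B t) = mask B (- t)" for t
      by (simp add: mask_def expo_minus)
    \<comment> \<open>Averaging \<open>expo x\<close> times the conjugate of \<open>expo y\<close>
      over \<open>B\<close> gives the mask at \<open>x - y\<close>; only the first factor is
      expanded.\<close>
    have "mask B (x - y) = (\<Sum>b\<in>B. (\<Sum>s\<in>\<Lambda>. mask B (x - s) * expo s (of_int b)) * cnj (expo y (of_int b))) / of_nat (card B)"
      unfolding mask_def [of B "x - y"] expo_diff using expand by simp
    also have "\<dots> = (\<Sum>s\<in>\<Lambda>. mask B (x - s) * (\<Sum>b\<in>B. expo (s - y) (of_int b))) / of_nat (card B)"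
      by (simp add: sum_distrib_right sum_distrib_left expo_diff mult.assoc) (subst sum.swap, simp)
    also have "\<dots> = (\<Sum>s\<in>\<Lambda>. mask B (x - s) * mask B (s - y))"
      by (simp add: mask_def [of B "_ - y"] sum_divide_distrib [symmetric])
    finally show ?thesis by (simp add: cnj)
  qed
  have "(\<Sum>l\<in>L. mask B ((x - of_int l) / ?a) * cnj (mask B ((y - of_int l) / ?a))) = mask B ((x - y) / ?a)" for x y
  proof -
    have inj: "inj_on (\<lambda>l. inverse ?a * real_of_int l) L" using a0 by (simp add: inj_on_def)
    have "(\<Sum>s\<in>\<Lambda>. mask B (x / ?a - s) * cnj (mask B (y / ?a - s)))
        = (\<Sum>l\<in>L. mask B ((x - of_int l) / ?a) * cnj (mask B ((y - of_int l) / ?a)))"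
    proof -
      have "(x - of_int l) / ?a = x / ?a - inverse ?a * of_int l" for x l
        by (simp add: divide_inverse algebra_simps)
      then show ?thesis unfolding \<Lambda>_def by (simp add: sum.reindex inj)
    qed
    then show ?thesis using main [of "x / ?a" "y / ?a"] by (simp add: diff_divide_distrib)
  qed
  then show ?thesis using A B L fin_L by unfold_locales auto
qed

theorem theorem3p35:
  fixes A :: int and B :: "int set"
  assumes "A \<ge> 2" and "finite B" and "0 \<in> B"
    and "\<exists>L :: int set. 0 \<in> L \<and>
      is_spectrum_of_set (real_of_int ` B) ((\<lambda>l. inverse (real_of_int A) * real_of_int l) ` L)"
    and "int (card B) < A"
  shows "infinite {\<Lambda>. is_spectrum (invariant_measure A B) \<Lambda>}"
proof -
  obtain L where L: "0 \<in> L"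
    "is_spectrum_of_set (real_of_int ` B) ((\<lambda>l. inverse (real_of_int A) * real_of_int l) ` L)"
    using assms(4) by blast
  interpret hadamard A B L
    using assms(1-3) L by (rule spectrum_of_set_imp_hadamard)
  let ?\<mu> = "invariant_measure A B"
  have inv: "is_invariant A B ?\<mu>"
    using A fin_B B_nonempty(1) by (rule invariant_measure)
  obtain R where R: "AE x in ?\<mu>. \<bar>x\<bar> \<le> R"
    using invariant_measure(2) [OF A fin_B B_nonempty(1)] by blast
  have "A \<noteq> 0" using A by simp
  interpret \<mu>: real_distribution ?\<mu>
    by (rule is_invariant_real_distribution [OF inv])
  have "\<exists>\<Lambda>. is_spectrum ?\<mu> \<Lambda>"
    using \<mu>.real_distribution_axioms R is_invariant_ft [OF inv \<open>A \<noteq> 0\<close>] by (rule spectrum_exists)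
  then show ?thesis using \<mu>.spectrum_imp_infinitely_many by blast
qed

end
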